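(* Let $\mathcal{F}=(\mathcal{X}_n,K_n,\pi_n)_{n=1}^\infty$ be a family of irreducible Markov chains on countable state spaces and $\mathcal{P}=(p_n)_{n=1}^\infty$ a sequence of positive reals. Let $\varrho_{\mathrm{TV}}=1$, $\varrho_H=2$, let $*\in\{\mathrm{TV},H\}$ and let $T^{(c)}_{n,*}$ be the mixing time of the $n$th chain in $\mathcal{F}_c$. Assume that there are constants $c_0\in(0,1)$, $N>0$ and a sequence $(\epsilon_n)_{n=1}^\infty$ satisfying $0<\inf_n\epsilon_n\le\sup_n\epsilon_n<1/(2\varrho_* )$ such that $$\max_{1\le i\le n}\frac{T^{(c)}_{i,*}(\epsilon_i)}{p_i}=\frac{T^{(c)}_{n,*}(\epsilon_n)}{p_n},\qquad\forall n\ge N,$$ and $$\lim_{m\to\infty}\limsup_{n\to\infty}\sum_{i=1}^{n-m}\Big(2\varrho_*\sup_{k\ge1}\epsilon_k\Big)^{c_0\varrho_*T^{(c)}_{n,*}(\epsilon_n)p_i/(T^{(c)}_{i,*}(\epsilon_i)p_n)}=0.$$ Then, with all cutoffs taken in the distance indicated by $*$: (1) $\mathcal{F}_c$ has a cutoff if and only if, for every increasing sequence of positive integers $\xi$, $\mathcal{F}^{\mathcal{P},\xi}_c$ has a cutoff. In particular, if $\mathcal{F}_c$ has a cutoff, then $\mathcal{F}^{\mathcal{P}}_c$ has a cutoff. (2) No subfamily of $\mathcal{F}_c$ has a cutoff if and only if, for every increasing sequence of positive integers $\xi$, $\mathcal{F}^{\mathcal{P},\xi}_c$ has no cutoff. In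 particular, if $\mathcal{F}_c$ has no subfamily presenting a cutoff, then $\mathcal{F}^{\mathcal{P}}_c$ has no cutoff. Further, if $\mathcal{F}_c$ has cutoff time $t_n$, then $\mathcal{F}^{\mathcal{P}}_c$ has cutoff time $q_nt_n/p_n$, where $q_n=p_1+\cdots+p_n$.
   Context: A chain $(\mathcal{X},K,\pi)$ has countable state space, irreducible stochastic matrix $K$, stationary distribution $\pi$; the associated continuous time chain has $H_t=e^{-t(I-K)}$. A subscript $c$ on a family denotes the family of associated continuous time chains. $d^{(c)}_{\mathrm{TV}}(t)=\sup_{x,A}\{H_t(x,A)-\pi(A)\}$, $d^{(c)}_H(t)=\sup_x\big(\frac12\sum_y(\sqrt{H_t(x,y)}-\sqrt{\pi(y)})^2\big)^{1/2}$, $T^{(c)}_*(\epsilon)=\inf\{t\ge0:d^{(c)}_*(t)\le\epsilon\}$. The mixing times $T^{(c)}_{n,*}(\epsilon_n)$ are understood to be finite and positive. $\mathcal{F}^{\mathcal{P}}$ is the family whose $n$th chain is the product of $(\mathcal{X}_i,K_i,\pi_i)_{i=1}^n$ according to $(p_1/q_n,\dots,p_n/q_n)$, i.e. the chain on $\prod_{i\le n}\mathcal{X}_i$ with stationary distribution $\pi_1\times\cdots\times\pi_n$ and transition matrix $\sum_{i=1}^n\frac{p_i}{q_n}I_1\otimes\cdots\otimes I_{i-1}\otimes K_i\otimes I_{i+1}\otimes\cdots\otimes I_n$. For an increasing sequence of positive integers $\xi=(\xi_n)$, $\mathcal{F}_\xi=(\mathcal{X}_{\xi_n},K_{\xi_n},\pi_{\xi_n})_{n=1}^\infty$,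 $\mathcal{P}_\xi=(p_{\xi_n})_{n=1}^\infty$ and $\mathcal{F}^{\mathcal{P},\xi}=(\mathcal{F}_\xi)^{\mathcal{P}_\xi}$. A subfamily of $\mathcal{F}_c$ is $(\mathcal{F}_\xi)_c$ for some such $\xi$. A family of continuous time chains with distances $d_n(t)$ has a cutoff with cutoff time $t_n>0$ if $d_n(at_n)\to0$ for all $a>1$ and $d_n(at_n)\to1$ for all $a\in(0,1)$; it has a cutoff if such $t_n$ exists. *)

theory Defs
  imports "HOL-Analysis.Analysis"
begin

text \<open>The state space is a subset of the ambient type, so that the members of a family may have
  different state spaces. Kernels and distributions are only meaningful on the state space.\<close>

record 'a mchain =
  states :: "'a set"
  kernel :: "'a \<Rightarrow> 'a \<Rightarrow> real"
  stat :: "'a \<Rightarrow> real"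

fun mat_pow :: "'a set \<Rightarrow> ('a \<Rightarrow> 'a \<Rightarrow> real) \<Rightarrow> nat \<Rightarrow> 'a \<Rightarrow> 'a \<Rightarrow> real" where
  "mat_pow X A 0 x y = of_bool (x = y)"
| "mat_pow X A (Suc m) x y = (\<Sum>\<^sub>\<infinity>z\<in>X. A x z * mat_pow X A m z y)"

definition mat_exp :: "'a set \<Rightarrow> ('a \<Rightarrow> 'a \<Rightarrow> real) \<Rightarrow> 'a \<Rightarrow> 'a \<Rightarrow> real" where
  "mat_exp X A x y = (\<Sum>m. mat_pow X A m x y / fact m)"

definition stochastic_on :: "'a set \<Rightarrow> ('a \<Rightarrow> 'a \<Rightarrow> real) \<Rightarrow> bool" where
  "stochastic_on X K \<longleftrightarrow> (\<forall>x\<in>X. (\<forall>y\<in>X. 0 \<le> K x y) \<and> ((\<lambda>y. K x y) has_sum 1) X)"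

definition irreducible_on :: "'a set \<Rightarrow> ('a \<Rightarrow> 'a \<Rightarrow> real) \<Rightarrow> bool" where
  "irreducible_on X K \<longleftrightarrow> (\<forall>x\<in>X. \<forall>y\<in>X. \<exists>m. mat_pow X K m x y > 0)"

definition stationary_distribution_on ::
    "'a set \<Rightarrow> ('a \<Rightarrow> 'a \<Rightarrow> real) \<Rightarrow> ('a \<Rightarrow> real) \<Rightarrow> bool" where
  "stationary_distribution_on X K \<pi> \<longleftrightarrow>
     (\<forall>x\<in>X. 0 \<le> \<pi> x) \<and> (\<pi> has_sum 1) X \<and>
     (\<forall>y\<in>X. ((\<lambda>x. \<pi> x * K x y) has_sum \<pi> y) X)"

definition irreducible_mchain :: "'a mchain \<Rightarrow> bool" where
  "irreducible_mchain C \<longleftrightarrow>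
     countable (states C) \<and> stochastic_on (states C) (kernel C) \<and>
     irreducible_on (states C) (kernel C) \<and>
     stationary_distribution_on (states C) (kernel C) (stat C)"

definition heat_kernel :: "'a mchain \<Rightarrow> real \<Rightarrow> 'a \<Rightarrow> 'a \<Rightarrow> real" where
  "heat_kernel C t = mat_exp (states C) (\<lambda>x y. - t * (of_bool (x = y) - kernel C x y))"

datatype dist_kind = TV | Hellinger

fun chain_dist :: "dist_kind \<Rightarrow> 'a mchain \<Rightarrow> real \<Rightarrow> real" where
  "chain_dist TV C t =
     Sup {(\<Sum>\<^sub>\<infinity>y\<in>A. heat_kernel C t x y) - (\<Sum>\<^sub>\<infinity>y\<in>A. stat C y) | x A.
       x \<in> states C \<and> A \<subseteq> states C}"
| "chain_dist Hellinger C t =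
     (SUP x\<in>states C.
        sqrt (1 / 2 * (\<Sum>\<^sub>\<infinity>y\<in>states C. (sqrt (heat_kernel C t x y) - sqrt (stat C y))\<^sup>2)))"

fun rho :: "dist_kind \<Rightarrow> real" where
  "rho TV = 1"
| "rho Hellinger = 2"

text \<open>The infimum is taken in the reals, so \<open>mixing_time\<close> is meaningful only if \<open>mixing_finite\<close>
  holds, i.e. if the infimum is over a nonempty set.\<close>

definition mixing_finite :: "dist_kind \<Rightarrow> 'a mchain \<Rightarrow> real \<Rightarrow> bool" where
  "mixing_finite D C \<epsilon> \<longleftrightarrow> (\<exists>t\<ge>0. chain_dist D C t \<le> \<epsilon>)"

definition mixing_time :: "dist_kind \<Rightarrow> 'a mchain \<Rightarrow> real \<Rightarrow> real" where
  "mixing_time D C \<epsilon> = Inf {t. 0 \<le> t \<and> chain_dist D C t \<le> \<epsilon>}"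

text \<open>All sequences and families are indexed by the positive integers; the value at index 0 is
  irrelevant.\<close>

definition weight_sum :: "(nat \<Rightarrow> real) \<Rightarrow> nat \<Rightarrow> real" where
  "weight_sum p n = (\<Sum>i=1..n. p i)"

text \<open>In the kernel, the \<open>i\<close>th summand is the entry at \<open>(x, y)\<close> of the tensor product with
  \<open>K\<^sub>i\<close> in position \<open>i\<close> and identity matrices in all other positions.\<close>

definition product_family ::
    "(nat \<Rightarrow> 'a mchain) \<Rightarrow> (nat \<Rightarrow> real) \<Rightarrow> nat \<Rightarrow> (nat \<Rightarrow> 'a) mchain" where
  "product_family F p n =
     \<lparr> states = (\<Pi>\<^sub>E i\<in>{1..n}. states (F i)),
       kernel = (\<lambda>x y. \<Sum>i=1..n. p i / weight_sum p n *
          (\<Prod>j=1..n. if j = i then kernel (F j) (x j) (y j) else of_bool (x j = y j))),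
       stat = (\<lambda>x. \<Prod>i=1..n. stat (F i) (x i)) \<rparr>"

definition increasing_pos_seq :: "(nat \<Rightarrow> nat) \<Rightarrow> bool" where
  "increasing_pos_seq \<xi> \<longleftrightarrow> (\<forall>n\<ge>1. 1 \<le> \<xi> n) \<and> strict_mono_on {1..} \<xi>"

definition cutoff_time :: "dist_kind \<Rightarrow> (nat \<Rightarrow> 'a mchain) \<Rightarrow> (nat \<Rightarrow> real) \<Rightarrow> bool" where
  "cutoff_time D F t \<longleftrightarrow>
     (\<forall>n\<ge>1. 0 < t n) \<and>
     (\<forall>a>1. (\<lambda>n. chain_dist D (F n) (a * t n)) \<longlonglongrightarrow> 0) \<and>
     (\<forall>a. 0 < a \<and> a < 1 \<longrightarrow> (\<lambda>n. chain_dist D (F n) (a * t n)) \<longlonglongrightarrow> 1)"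

definition has_cutoff :: "dist_kind \<Rightarrow> (nat \<Rightarrow> 'a mchain) \<Rightarrow> bool" where
  "has_cutoff D F \<longleftrightarrow> (\<exists>t. cutoff_time D F t)"

end

theory Submission
  imports Defs
begin

text \<open>
  Let \<open>d\<^sub>i\<close> be the distance to stationarity of the \<open>i\<close>th chain, \<open>d\<close> that of the product of the first
  \<open>n\<close> chains, \<open>T\<^sub>i\<close> the mixing time of the \<open>i\<close>th chain, \<open>q\<close> the sum of the first \<open>n\<close> weights and \<open>\<rho>\<close>
  the exponent \<open>rho D\<close>. The theorem only depends on the following properties of these distances.

  \<^item> \<open>d\<^sub>i\<close> is nonincreasing and \<open>d\<^sub>i (s + t) \<le> 2 \<rho> d\<^sub>i s d\<^sub>i t\<close> (\<open>chain_dist_antimono\<close>,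
    \<open>chain_dist_submult\<close>). Hence \<open>d\<^sub>i (x T\<^sub>i)\<close> decays like \<open>\<theta>\<close> to the power \<open>x\<close>, with
    \<open>\<theta> = 2 \<rho> sup \<epsilon> < 1\<close>.
  \<^item> At time \<open>q u / p\<^sub>n\<close> the product has run its \<open>i\<close>th coordinate independently of the others for the
    time \<open>u p\<^sub>i / p\<^sub>n\<close>. So \<open>d\<close> is at least every \<open>d\<^sub>i (u p\<^sub>i / p\<^sub>n)\<close>; and if \<open>g\<close> and \<open>g\<^sub>i\<close> denote the
    powers of \<open>d\<close> and \<open>d\<^sub>i (u p\<^sub>i / p\<^sub>n)\<close> with exponent \<open>\<rho>\<close>, then \<open>1 - g\<close> is at least the product
    of the \<open>1 - g\<^sub>i\<close> (\<open>chain_dist_product_ge\<close>, \<open>chain_dist_product_le\<close>).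

  If \<open>u \<ge> a T\<^sub>n\<close> with \<open>a > c\<^sub>0\<close>, then the decay turns the summability assumption into the statement that
  the coordinates \<open>i \<le> n - m\<close> together contribute arbitrarily little once \<open>m\<close> and \<open>n\<close> are large
  (\<open>early_components_negligible\<close>). The product is therefore governed by the last \<open>m\<close> coordinates.

  \<^item> Suppose that the family has cutoff time \<open>t\<close>. Then \<open>T\<close> is a cutoff time as well. For \<open>u = a t\<^sub>n\<close>
    with \<open>a > 1\<close> the maximality assumption gives each of the last \<open>m\<close> coordinates more than its own
    mixing time, by a factor bounded away from \<open>1\<close>, so that their distances vanish; for \<open>a < 1\<close> the
    last coordinate alone keeps the product far from equilibrium (\<open>product_cutoff_time\<close>).
  \<^item> Suppose that the product has cutoff time \<open>q u\<^sub>n / p\<^sub>n\<close>. Just before that time one of the last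
    \<open>m\<close> coordinates must itself be far from equilibrium, because the product of the \<open>1 - g\<^sub>i\<close> is
    small while the early coordinates contribute a factor of at least \<open>1 / 2\<close>. This is where
    \<open>c\<^sub>0 < 1\<close> enters: the early coordinates are under control already slightly below \<open>T\<^sub>n\<close>. Just after
    that time all coordinates are close to equilibrium. Selecting such coordinates along a sequence
    of \<open>n\<close> yields a subfamily with a cutoff (\<open>subfamily_cutoff\<close>).

  All assumptions pass to subfamilies (\<open>subfamily\<close>), and a family without cutoff has a subfamily none
  of whose subfamilies has a cutoff (\<open>no_cutoff_subfamily\<close>). The equivalences follow.

  Both distances are treated at once. The distance to the power \<open>\<rho>\<close> is the supremum over the starting
  point of \<open>1\<close> minus the sum over \<open>y\<close> of an overlap of \<open>H\<^sub>t(x,y)\<close> and \<open>\<pi>(y)\<close>, where the overlap of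
  \<open>a\<close> and \<open>b\<close> is \<open>min a b\<close> for total variation and \<open>sqrt (a b)\<close> for the Hellinger distance. Both overlaps
  are homogeneous, concave and supermultiplicative, which gives everything except for the
  submultiplicativity with its precise constant \<open>2 \<rho>\<close>; the latter is \<open>discrepancy_mixture\<close>.
\<close>

section \<open>Sums over infinite sets\<close>

lemma has_sum_swap_nonneg:
  fixes f :: "'a \<Rightarrow> 'b \<Rightarrow> real"
  assumes nonneg: "\<And>x y. x \<in> A \<Longrightarrow> y \<in> B \<Longrightarrow> 0 \<le> f x y"
    and rows: "\<And>x. x \<in> A \<Longrightarrow> (f x has_sum g x) B"
    and total: "(g has_sum S) A"
    and cols: "\<And>y. y \<in> B \<Longrightarrow> ((\<lambda>x. f x y) has_sum h y) A"
  shows "(h has_sum S) B"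
proof -
  let ?f = "\<lambda>(x, y). f x y"
  have "?f summable_on A \<times> B"
    using summable_on_SigmaI[where f = ?f and A = A and B = "\<lambda>_. B" and g = g] rows total nonneg has_sum_imp_summable[OF total]
    by auto
  then have "(?f has_sum S) (A \<times> B)"
    using has_sum_SigmaI[where f = ?f and A = A and B = "\<lambda>_. B" and g = g and S = S] rows total by auto
  then have "((\<lambda>(y, x). f x y) has_sum S) (B \<times> A)"
    using has_sum_swap[of ?f A B S] by (simp add: case_prod_unfold)
  then show ?thesis
    using has_sum_SigmaD[where f = "\<lambda>(y, x). f x y" and A = B and B = "\<lambda>_. A" and g = h and S = S] cols by auto
qed

text \<open>Each column converges because it is dominated by the convergent family of row sums.\<close>

lemma has_sum_swap_nonneg_infsum:
  fixes f :: "'a \<Rightarrow> 'b \<Rightarrow> real"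
  assumes nonneg: "\<And>x y. x \<in> A \<Longrightarrow> y \<in> B \<Longrightarrow> 0 \<le> f x y"
    and rows: "\<And>x. x \<in> A \<Longrightarrow> (f x has_sum g x) B"
    and total: "(g has_sum S) A"
  shows "y \<in> B \<Longrightarrow> (\<lambda>x. f x y) summable_on A"
    and "((\<lambda>y. \<Sum>\<^sub>\<infinity>x\<in>A. f x y) has_sum S) B"
proof -
  show cols: "(\<lambda>x. f x y) summable_on A" if "y \<in> B" for y
  proof (rule summable_on_comparison_test[OF has_sum_imp_summable[OF total]])
    fix x assume x: "x \<in> A"
    show "f x y \<le> g x"
      using finite_sum_le_has_sum[OF rows[OF x], of "{y}"] that nonneg[OF x] by auto
  qed (use nonneg that in auto)
  show "((\<lambda>y. \<Sum>\<^sub>\<infinity>x\<in>A. f x y) has_sum S) B"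
    using has_sum_swap_nonneg[OF nonneg rows total] cols by auto
qed

lemma has_sum_diff:
  fixes f g :: "'a \<Rightarrow> real"
  assumes "(f has_sum a) A" "(g has_sum b) A"
  shows "((\<lambda>x. f x - g x) has_sum (a - b)) A"
  using has_sum_add[OF assms(1), of "\<lambda>x. - g x" "- b"] assms(2) by (simp add: has_sum_uminus)

lemma has_sum_sum:
  fixes f :: "'i \<Rightarrow> 'a \<Rightarrow> real"
  assumes "\<And>i. i \<in> I \<Longrightarrow> (f i has_sum S i) A"
  shows "((\<lambda>x. \<Sum>i\<in>I. f i x) has_sum (\<Sum>i\<in>I. S i)) A"
  using assms by (induction I rule: infinite_finite_induct) (auto intro: has_sum_add)

lemma has_sum_delta_mult:
  fixes f :: "'a \<Rightarrow> real"
  assumes "x \<in> A"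
  shows "((\<lambda>z. of_bool (x = z) * f z) has_sum f x) A"
  using has_sum_finite_neutralI[of "{x}" A "\<lambda>z. of_bool (x = z) * f z" "f x"] assms by auto

lemma has_sum_prod_PiE_nonneg:
  fixes f :: "'i \<Rightarrow> 'a \<Rightarrow> real"
  assumes fin: "finite I"
    and nonneg: "\<And>i x. i \<in> I \<Longrightarrow> x \<in> X i \<Longrightarrow> 0 \<le> f i x"
    and sums: "\<And>i. i \<in> I \<Longrightarrow> (f i has_sum S i) (X i)"
  shows "((\<lambda>g. \<Prod>i\<in>I. f i (g i)) has_sum (\<Prod>i\<in>I. S i)) (PiE I X)"
proof (cases "\<exists>i\<in>I. S i = 0")
  case True
  then obtain i where i: "i \<in> I" "S i = 0" by blast
  have "f i x = 0" if "x \<in> X i" for x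
    using nonneg_has_sum_le_0D[OF sums[OF i(1)]] i nonneg that by auto
  then have "(\<Prod>i\<in>I. f i (g i)) = 0" if "g \<in> PiE I X" for g
    using that i fin by (auto intro!: prod_zero)
  moreover have "(\<Prod>i\<in>I. S i) = 0"
    using i fin by (auto intro!: prod_zero)
  ultimately show ?thesis by (auto intro: has_sum_0)
next
  case False
  have abs: "(\<lambda>x. norm (f i x)) summable_on X i" if "i \<in> I" for i
    using has_sum_imp_summable[OF sums[OF that]] summable_on_iff_abs_summable_on_real by blast
  have inf: "infsum (\<lambda>g. \<Prod>i\<in>I. f i (g i)) (PiE I X) = (\<Prod>i\<in>I. S i)"
    by (subst infsum_prod_PiE_abs[OF fin abs]) (use sums in \<open>auto simp: has_sum_iff intro!: prod.cong\<close>)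
  \<comment> \<open>A divergent family has sum \<open>0\<close> by convention, so that a nonzero value forces convergence.\<close>
  have "infsum (\<lambda>g. \<Prod>i\<in>I. f i (g i)) (PiE I X) \<noteq> 0"
    unfolding inf using False fin by auto
  then have "(\<lambda>g. \<Prod>i\<in>I. f i (g i)) summable_on PiE I X"
    using infsum_not_exists by blast
  then show ?thesis
    using inf by (auto simp: has_sum_iff)
qed

section \<open>Exponentials of matrices with bounded rows\<close>

text \<open>The generators have entries of both signs, so that the interchange of sums has to be justified by
  absolute convergence. Matrices with uniformly bounded rows in \<open>l\<^sup>1\<close> have an everywhere convergent exponential.\<close>

definition rows_bounded :: "'a set \<Rightarrow> ('a \<Rightarrow> 'a \<Rightarrow> real) \<Rightarrow> real \<Rightarrow> bool" where
  "rows_bounded X A c \<longleftrightarrow> 0 \<le> c \<and> (\<forall>x\<in>X. (\<lambda>z. \<bar>A x z\<bar>) summable_on X \<and> (\<Sum>\<^sub>\<infinity>z\<in>X. \<bar>A x z\<bar>) \<le> c)"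

lemma rows_bounded_mult:
  assumes "rows_bounded X A c" "x \<in> X" "\<And>z. z \<in> X \<Longrightarrow> \<bar>b z\<bar> \<le> B"
  shows "(\<lambda>z. A x z * b z) summable_on X" "\<bar>\<Sum>\<^sub>\<infinity>z\<in>X. A x z * b z\<bar> \<le> c * B"
proof -
  have A: "(\<lambda>z. \<bar>A x z\<bar>) summable_on X" "(\<Sum>\<^sub>\<infinity>z\<in>X. \<bar>A x z\<bar>) \<le> c" 
    using assms by (auto simp: rows_bounded_def)
  have B: "0 \<le> B" using assms(2,3) by fastforce
  have le: "\<bar>A x z * b z\<bar> \<le> \<bar>A x z\<bar> * B" if "z \<in> X" for z
    using assms(3)[OF that] by (auto simp: abs_mult intro: mult_left_mono)
  have AB: "(\<lambda>z. \<bar>A x z\<bar> * B) summable_on X"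
    using A(1) by (rule summable_on_cmult_left)
  have s: "(\<lambda>z. norm (A x z * b z)) summable_on X"
    using summable_on_comparison_test[OF AB] le by auto
  then show "(\<lambda>z. A x z * b z) summable_on X"
    by (rule abs_summable_summable)
  have "\<bar>\<Sum>\<^sub>\<infinity>z\<in>X. A x z * b z\<bar> \<le> (\<Sum>\<^sub>\<infinity>z\<in>X. \<bar>A x z * b z\<bar>)"
    using norm_infsum_bound[OF s] by simp
  also have "\<dots> \<le> (\<Sum>\<^sub>\<infinity>z\<in>X. \<bar>A x z\<bar> * B)"
    using s AB le by (intro infsum_mono) auto
  also have "\<dots> = (\<Sum>\<^sub>\<infinity>z\<in>X. \<bar>A x z\<bar>) * B"
    by (rule infsum_cmult_left')
  also have "\<dots> \<le> c * B"
    using A(2) B by (rule mult_right_mono)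
  finally show "\<bar>\<Sum>\<^sub>\<infinity>z\<in>X. A x z * b z\<bar> \<le> c * B" .
qed

lemma mat_pow_bound:
  assumes "rows_bounded X A c" "x \<in> X"
  shows "\<bar>mat_pow X A m x y\<bar> \<le> c ^ m"
  using assms(2)
proof (induction m arbitrary: x)
  case (Suc m)
  then show ?case using rows_bounded_mult(2)[OF assms(1) Suc.prems, of "\<lambda>z. mat_pow X A m z y" "c ^ m"] by simp
qed auto

lemma mat_pow_Suc_has_sum:
  assumes "rows_bounded X A c" "x \<in> X"
  shows "((\<lambda>z. A x z * mat_pow X A m z y) has_sum mat_pow X A (Suc m) x y) X"
  using rows_bounded_mult(1)[OF assms, of "\<lambda>z. mat_pow X A m z y" "c ^ m"] mat_pow_bound[OF assms(1)]
  by (auto intro: has_sum_infsum)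

text \<open>The exponential of \<open>s A\<close> as a power series in a formal variable \<open>s\<close>. Identities between
  exponentials are proved coefficientwise, and evaluated at \<open>s = 1\<close> only at the end.\<close>

definition exp_fps :: "'a set \<Rightarrow> ('a \<Rightarrow> 'a \<Rightarrow> real) \<Rightarrow> 'a \<Rightarrow> 'a \<Rightarrow> real fps" where
  "exp_fps X A x y = Abs_fps (\<lambda>m. mat_pow X A m x y / fact m)"

lemma mat_exp_eq_eval_fps: "mat_exp X A x y = eval_fps (exp_fps X A x y) 1"
  by (simp add: mat_exp_def eval_fps_def exp_fps_def)

lemma fps_conv_radius_exp_fps:
  assumes "rows_bounded X A c" "x \<in> X"
  shows "fps_conv_radius (exp_fps X A x y) = \<infinity>"
  unfolding fps_conv_radius_def exp_fps_def
proof (rule conv_radius_inftyI'')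
  fix z :: real
  have "summable (\<lambda>m. \<bar>c * z\<bar> ^ m / fact m)"
    using summable_exp[of "\<bar>c * z\<bar>"] by (simp add: field_simps)
  then show "summable (\<lambda>m. fps_nth (Abs_fps (\<lambda>m. mat_pow X A m x y / fact m)) m * z ^ m)"
  proof (rule summable_comparison_test')
    fix m :: nat
    have "\<bar>mat_pow X A m x y\<bar> * \<bar>z ^ m\<bar> \<le> c ^ m * \<bar>z ^ m\<bar>"
      by (intro mult_right_mono mat_pow_bound[OF assms]) auto
    also have "\<dots> = \<bar>c * z\<bar> ^ m"
      using assms(1) by (simp add: rows_bounded_def abs_mult power_abs power_mult_distrib)
    finally have "\<bar>mat_pow X A m x y\<bar> * \<bar>z ^ m\<bar> / fact m \<le> \<bar>c * z\<bar> ^ m / fact m"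
      by (intro divide_right_mono) auto
    then show "norm (fps_nth (Abs_fps (\<lambda>m. mat_pow X A m x y / fact m)) m * z ^ m) \<le> \<bar>c * z\<bar> ^ m / fact m"
      by (simp add: abs_mult)
  qed
qed

lemma exp_fps_deriv_has_sum:
  assumes "rows_bounded X A c" "x \<in> X"
  shows "((\<lambda>z. A x z * fps_nth (exp_fps X A z y) m) has_sum
      fps_nth (fps_deriv (exp_fps X A x y)) m) X"
  using has_sum_cmult_left[OF mat_pow_Suc_has_sum[OF assms, of m y], of "1 / fact m"]
  by (simp add: exp_fps_def del: mat_pow.simps of_nat_Suc of_nat_add)

text \<open>Kolmogorov's backward equation, read coefficientwise, determines the exponential: its \<open>m\<close>th
  coefficient expresses the coefficient of order \<open>m + 1\<close> through those of order \<open>m\<close>.\<close>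

lemma exp_fps_unique:
  assumes init: "\<And>x. x \<in> X \<Longrightarrow> fps_nth (\<phi> x) 0 = of_bool (x = y)"
    and deriv: "\<And>x m. x \<in> X \<Longrightarrow>
      ((\<lambda>z. A x z * fps_nth (\<phi> z) m) has_sum fps_nth (fps_deriv (\<phi> x)) m) X"
    and x: "x \<in> X"
  shows "exp_fps X A x y = \<phi> x"
proof -
  have "mat_pow X A m x y = fact m * fps_nth (\<phi> x) m" if "x \<in> X" for x m
    using that
  proof (induction m arbitrary: x)
    case 0
    then show ?case using init by simp
  next
    case (Suc m)
    have "mat_pow X A (Suc m) x y = (\<Sum>\<^sub>\<infinity>z\<in>X. fact m * (A x z * fps_nth (\<phi> z) m))"
      using Suc.IH by (auto intro!: infsum_cong)
    also have "\<dots> = fact m * fps_nth (fps_deriv (\<phi> x)) m"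
      using infsumI[OF deriv[OF Suc.prems, of m]] by (simp add: infsum_cmult_right')
    also have "\<dots> = fact (Suc m) * fps_nth (\<phi> x) (Suc m)"
      by (simp add: algebra_simps)
    finally show ?case .
  qed
  with x show ?thesis
    by (intro fps_ext) (simp add: exp_fps_def)
qed

lemma fps_conv_radius_prod_infinity:
  fixes f :: "'i \<Rightarrow> real fps"
  assumes "finite I" "\<And>i. i \<in> I \<Longrightarrow> fps_conv_radius (f i) = \<infinity>"
  shows "fps_conv_radius (\<Prod>i\<in>I. f i) = \<infinity>"
  using assms
proof (induction I)
  case (insert i I)
  then show ?case
    using fps_conv_radius_mult[of "f i" "\<Prod>i\<in>I. f i"] by simp
qed auto

lemma eval_fps_prod:
  fixes f :: "'i \<Rightarrow> real fps"
  assumes "finite I" "\<And>i. i \<in> I \<Longrightarrow> fps_conv_radius (f i) = \<infinity>"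
  shows "eval_fps (\<Prod>i\<in>I. f i) z = (\<Prod>i\<in>I. eval_fps (f i) z)"
  using assms
proof (induction I)
  case (insert i I)
  then show ?case
    using fps_conv_radius_prod_infinity[of I f] by (simp add: eval_fps_mult)
qed auto

lemma fps_nth_0_prod:
  fixes f :: "'i \<Rightarrow> real fps"
  shows "fps_nth (\<Prod>i\<in>I. f i) 0 = (\<Prod>i\<in>I. fps_nth (f i) 0)"
  by (induction I rule: infinite_finite_induct) auto

lemma fps_deriv_prod:
  fixes f :: "'i \<Rightarrow> real fps"
  assumes "finite I"
  shows "fps_deriv (\<Prod>i\<in>I. f i) = (\<Sum>i\<in>I. fps_deriv (f i) * (\<Prod>j\<in>I - {i}. f j))"
  using assms
proof (induction I)
  case (insert i I)
  have "f i * (\<Prod>k\<in>I - {j}. f k) = (\<Prod>k\<in>insert i I - {j}. f k)" if "j \<in> I" for j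
  proof -
    have "insert i I - {j} = insert i (I - {j})" using insert that by auto
    then show ?thesis using insert by simp
  qed
  then have "f i * (\<Sum>j\<in>I. fps_deriv (f j) * (\<Prod>k\<in>I - {j}. f k)) =
      (\<Sum>j\<in>I. fps_deriv (f j) * (\<Prod>k\<in>insert i I - {j}. f k))"
    unfolding sum_distrib_left by (intro sum.cong refl) (simp add: mult.left_commute)
  then show ?case
    using insert by (simp add: algebra_simps)
qed auto

lemma mat_exp_cong:
  assumes "\<And>x y. x \<in> X \<Longrightarrow> y \<in> X \<Longrightarrow> A x y = B x y" "x \<in> X"
  shows "mat_exp X A x y = mat_exp X B x y"
proof -
  have "mat_pow X A m x y = mat_pow X B m x y" if "x \<in> X" for m x
    using that by (induction m arbitrary: x) (use assms(1) in \<open>auto intro!: infsum_cong\<close>)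
  with assms(2) show ?thesis by (simp add: mat_exp_def)
qed

text \<open>The generator of independent coordinates: the \<open>i\<close>th summand acts by \<open>A i\<close> on coordinate \<open>i\<close>
  and by the identity on all the others.\<close>

definition kronecker_sum ::
    "'i set \<Rightarrow> ('i \<Rightarrow> 'a \<Rightarrow> 'a \<Rightarrow> real) \<Rightarrow> ('i \<Rightarrow> 'a) \<Rightarrow> ('i \<Rightarrow> 'a) \<Rightarrow> real" where
  "kronecker_sum I A x z = (\<Sum>i\<in>I. A i (x i) (z i) * (\<Prod>j\<in>I - {i}. of_bool (x j = z j)))"

text \<open>The summands of a Kronecker sum only connect \<open>x\<close> with points that differ from it in at most
  one coordinate.\<close>

lemma has_sum_one_coordinate:
  fixes f :: "('i \<Rightarrow> 'a) \<Rightarrow> real"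
  assumes fin: "finite I" and i: "i \<in> I" and x: "x \<in> PiE I X"
    and sum: "((\<lambda>a. B a * f (x(i := a))) has_sum S) (X i)"
  shows "((\<lambda>z. B (z i) * (\<Prod>j\<in>I - {i}. of_bool (x j = z j)) * f z) has_sum S) (PiE I X)"
    (is "(?g has_sum S) _")
proof -
  let ?u = "\<lambda>a. x(i := a)"
  have inj: "inj_on ?u (X i)"
    by (rule inj_onI) (metis fun_upd_same)
  have "((?g \<circ> ?u) has_sum S) (X i)"
    using sum by (rule has_sum_cong[THEN iffD1, rotated]) auto
  then have 1: "(?g has_sum S) (?u ` X i)"
    using has_sum_reindex[OF inj] by blast
  have sub: "?u ` X i \<subseteq> PiE I X"
    using x i by (auto simp: PiE_iff extensional_def)
  have "?g z = 0" if z: "z \<in> PiE I X - ?u ` X i" for z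
  proof -
    have "\<exists>j\<in>I - {i}. x j \<noteq> z j"
    proof (rule ccontr)
      assume "\<not> ?thesis"
      then have "z = ?u (z i)"
        using x z i by (intro PiE_ext[of _ I "\<lambda>_. UNIV"]) (simp_all add: PiE_iff extensional_def)
      with z i show False by (auto simp: PiE_iff)
    qed
    with fin show ?thesis by auto
  qed
  with 1 sub show ?thesis
    by (subst has_sum_cong_neutral[where T = "?u ` X i" and g = ?g]) auto
qed

text \<open>Coordinates evolve independently: the product of the coordinate exponentials satisfies the
  backward equation of the Kronecker sum by the Leibniz rule, so uniqueness identifies it with the
  exponential of the Kronecker sum.\<close>

theorem mat_exp_kronecker_sum:
  assumes fin: "finite I"
    and bdd: "\<And>i. i \<in> I \<Longrightarrow> rows_bounded (X i) (A i) (c i)"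
    and x: "x \<in> PiE I X" and y: "y \<in> PiE I X"
  shows "mat_exp (PiE I X) (kronecker_sum I A) x y = (\<Prod>i\<in>I. mat_exp (X i) (A i) (x i) (y i))"
proof -
  define \<phi> where "\<phi> x = (\<Prod>i\<in>I. exp_fps (X i) (A i) (x i) (y i))" for x
  have "exp_fps (PiE I X) (kronecker_sum I A) x y = \<phi> x"
  proof (rule exp_fps_unique[OF _ _ x])
    fix x assume x: "x \<in> PiE I X"
    have "fps_nth (\<phi> x) 0 = (\<Prod>i\<in>I. of_bool (x i = y i))"
      by (simp add: \<phi>_def fps_nth_0_prod exp_fps_def)
    also have "\<dots> = of_bool (x = y)"
      using fin PiE_ext[OF x y] by (cases "x = y") auto
    finally show "fps_nth (\<phi> x) 0 = of_bool (x = y)" .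
  next
    fix x m assume x: "x \<in> PiE I X"
    define R where "R i = (\<Prod>j\<in>I - {i}. exp_fps (X j) (A j) (x j) (y j))" for i
    have split: "\<phi> (x(i := a)) = exp_fps (X i) (A i) a (y i) * R i" if "i \<in> I" for i a
      using fin that by (auto simp: \<phi>_def R_def prod.remove[OF fin that] intro!: prod.cong)
    have one: "((\<lambda>z. A i (x i) (z i) * (\<Prod>j\<in>I - {i}. of_bool (x j = z j)) * fps_nth (\<phi> z) m)
        has_sum fps_nth (fps_deriv (exp_fps (X i) (A i) (x i) (y i)) * R i) m) (PiE I X)"
      if i: "i \<in> I" for i
    proof (rule has_sum_one_coordinate[OF fin i x])
      have xi: "x i \<in> X i" using x i by auto
      have "((\<lambda>a. \<Sum>k=0..m. A i (x i) a * fps_nth (exp_fps (X i) (A i) a (y i)) k * fps_nth (R i) (m - k))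
          has_sum (\<Sum>k=0..m. fps_nth (fps_deriv (exp_fps (X i) (A i) (x i) (y i))) k * fps_nth (R i) (m - k))) (X i)"
        by (intro has_sum_sum has_sum_cmult_left exp_fps_deriv_has_sum[OF bdd[OF i] xi])
      then show "((\<lambda>a. A i (x i) a * fps_nth (\<phi> (x(i := a))) m) has_sum
          fps_nth (fps_deriv (exp_fps (X i) (A i) (x i) (y i)) * R i) m) (X i)"
        by (simp add: split[OF i] fps_mult_nth sum_distrib_left mult.assoc del: fps_deriv_nth)
    qed
    have "((\<lambda>z. \<Sum>i\<in>I. A i (x i) (z i) * (\<Prod>j\<in>I - {i}. of_bool (x j = z j)) * fps_nth (\<phi> z) m)
        has_sum (\<Sum>i\<in>I. fps_nth (fps_deriv (exp_fps (X i) (A i) (x i) (y i)) * R i) m)) (PiE I X)"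
      by (intro has_sum_sum one)
    then show "((\<lambda>z. kronecker_sum I A x z * fps_nth (\<phi> z) m) has_sum
        fps_nth (fps_deriv (\<phi> x)) m) (PiE I X)"
      by (simp add: \<phi>_def fps_deriv_prod[OF fin] R_def kronecker_sum_def sum_distrib_right
          fps_sum_nth del: fps_deriv_nth)
  qed
  then show ?thesis
    using x fin bdd by (auto simp: mat_exp_eq_eval_fps \<phi>_def PiE_iff
        intro!: eval_fps_prod fps_conv_radius_exp_fps)
qed

section \<open>The continuous time chain\<close>

lemma rows_bounded_stochastic:
  assumes "stochastic_on X K"
  shows "rows_bounded X K 1"
  unfolding rows_bounded_def
proof (intro conjI ballI)
  fix x assume x: "x \<in> X"
  have *: "\<bar>K x z\<bar> = K x z" if "z \<in> X" for z
    using assms x that by (auto simp: stochastic_on_def)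
  have "(K x has_sum 1) X"
    using assms x by (auto simp: stochastic_on_def)
  then have "((\<lambda>z. \<bar>K x z\<bar>) has_sum 1) X"
    using has_sum_cong[of X "\<lambda>z. \<bar>K x z\<bar>" "K x"] * by simp
  then show "(\<lambda>z. \<bar>K x z\<bar>) summable_on X" "(\<Sum>\<^sub>\<infinity>z\<in>X. \<bar>K x z\<bar>) \<le> 1"
    by (auto simp: has_sum_iff)
qed auto

lemma rows_bounded_generator:
  assumes "stochastic_on X K"
  shows "rows_bounded X (\<lambda>x y. s * (of_bool (x = y) - K x y)) (2 * \<bar>s\<bar>)"
  unfolding rows_bounded_def
proof (intro conjI ballI)
  fix x assume x: "x \<in> X"
  let ?g = "\<lambda>z. \<bar>s\<bar> * (of_bool (x = z) * 1 + K x z)"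
  have nn: "0 \<le> K x z" if "z \<in> X" for z
    using assms x that by (auto simp: stochastic_on_def)
  have K: "(K x has_sum 1) X"
    using assms x by (auto simp: stochastic_on_def)
  have g: "(?g has_sum \<bar>s\<bar> * (1 + 1)) X"
    by (intro has_sum_cmult_right has_sum_add has_sum_delta_mult x K)
  have le: "\<bar>s * (of_bool (x = z) - K x z)\<bar> \<le> ?g z" if "z \<in> X" for z
    using nn[OF that] by (auto simp: abs_mult intro!: mult_left_mono)
  show *: "(\<lambda>z. \<bar>s * (of_bool (x = z) - K x z)\<bar>) summable_on X"
    by (rule summable_on_comparison_test[OF has_sum_imp_summable[OF g]]) (use le in auto)
  show "(\<Sum>\<^sub>\<infinity>z\<in>X. \<bar>s * (of_bool (x = z) - K x z)\<bar>) \<le> 2 * \<bar>s\<bar>"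
    using has_sum_mono[OF has_sum_infsum[OF *] g le] by simp
qed auto

text \<open>The weights of the Poisson distribution with mean \<open>t\<close>.\<close>

definition pois :: "real \<Rightarrow> nat \<Rightarrow> real" where
  "pois t m = exp (- t) * (t ^ m / fact m)"

lemma pois_nonneg: "0 \<le> t \<Longrightarrow> 0 \<le> pois t m"
  by (simp add: pois_def)

lemma pois_has_sum: "0 \<le> t \<Longrightarrow> (pois t has_sum 1) UNIV"
proof (rule sums_nonneg_imp_has_sum)
  have "(\<lambda>m. t ^ m / fact m) sums exp t"
    using exp_converges[of t] by (simp add: field_simps)
  from sums_mult[OF this, of "exp (- t)"] show "pois t sums 1"
    by (simp add: pois_def[abs_def] flip: exp_add)
qed (simp add: pois_nonneg)

lemma pois_convolution: "(\<Sum>m\<le>k. pois s m * pois t (k - m)) = pois (s + t) k"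
proof -
  have "(\<Sum>m\<le>k. pois s m * pois t (k - m)) =
      exp (- (s + t)) * ((\<Sum>m\<le>k. of_nat (k choose m) * s ^ m * t ^ (k - m)) / fact k)"
    unfolding sum_divide_distrib sum_distrib_left
    by (rule sum.cong) (auto simp: pois_def binomial_fact exp_add exp_minus exp_diff field_simps)
  also have "\<dots> = pois (s + t) k"
    by (simp add: pois_def binomial_ring)
  finally show ?thesis .
qed

locale stochastic =
  fixes X :: "'a set" and K :: "'a \<Rightarrow> 'a \<Rightarrow> real"
  assumes stoch: "stochastic_on X K"
begin

lemma K_nonneg: "x \<in> X \<Longrightarrow> y \<in> X \<Longrightarrow> 0 \<le> K x y"
  using stoch by (auto simp: stochastic_on_def)

lemma K_row: "x \<in> X \<Longrightarrow> (K x has_sum 1) X"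
  using stoch by (auto simp: stochastic_on_def)

abbreviation P :: "nat \<Rightarrow> 'a \<Rightarrow> 'a \<Rightarrow> real" where
  "P \<equiv> mat_pow X K"

lemmas P_Suc = mat_pow_Suc_has_sum[OF rows_bounded_stochastic[OF stoch]]

lemma P_nonneg: "x \<in> X \<Longrightarrow> y \<in> X \<Longrightarrow> 0 \<le> P m x y"
  by (induction m arbitrary: x) (auto intro!: infsum_nonneg mult_nonneg_nonneg K_nonneg)

lemma P_row: "x \<in> X \<Longrightarrow> (P m x has_sum 1) X"
proof (induction m arbitrary: x)
  case 0
  then show ?case using has_sum_delta_mult[of x X "\<lambda>_. 1"] by simp
next
  case (Suc m)
  show ?case
  proof (rule has_sum_swap_nonneg[where f = "\<lambda>z y. K x z * P m z y" and g = "K x"])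
    show "((\<lambda>y. K x z * P m z y) has_sum K x z) X" if "z \<in> X" for z
      using has_sum_cmult_right[OF Suc.IH[OF that], of "K x z"] by simp
  qed (use Suc.prems K_nonneg P_nonneg K_row P_Suc in auto)
qed

lemma P_add:
  "x \<in> X \<Longrightarrow> y \<in> X \<Longrightarrow> ((\<lambda>z. P m x z * P l z y) has_sum P (m + l) x y) X"
proof (induction m arbitrary: x)
  case 0
  then show ?case using has_sum_delta_mult[of x X "\<lambda>z. P l z y"] by simp
next
  case (Suc m)
  show ?case
  proof (rule has_sum_swap_nonneg[where f = "\<lambda>w z. K x w * (P m w z * P l z y)"
        and g = "\<lambda>w. K x w * P (m + l) w y"])
    show "((\<lambda>z. K x w * (P m w z * P l z y)) has_sum K x w * P (m + l) w y) X" if "w \<in> X" for w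
      by (rule has_sum_cmult_right[OF Suc.IH[OF that Suc.prems(2)]])
    show "((\<lambda>w. K x w * P (m + l) w y) has_sum P (Suc m + l) x y) X"
      using P_Suc[OF Suc.prems(1), of "m + l" y] by simp
    show "((\<lambda>w. K x w * (P m w z * P l z y)) has_sum P (Suc m) x z * P l z y) X" for z
      using has_sum_cmult_left[OF P_Suc[OF Suc.prems(1), of m z], of "P l z y"]
      by (simp add: mult.assoc)
  qed (use Suc.prems K_nonneg P_nonneg in auto)
qed

lemma P_stationary:
  assumes "stationary_distribution_on X K \<pi>"
  shows "y \<in> X \<Longrightarrow> ((\<lambda>x. \<pi> x * P m x y) has_sum \<pi> y) X"
proof (induction m arbitrary: y)
  case 0
  then show ?case using has_sum_delta_mult[of y X \<pi>] by (simp add: mult.commute eq_commute)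
next
  case (Suc m)
  have \<pi>: "\<And>x. x \<in> X \<Longrightarrow> 0 \<le> \<pi> x" "\<And>y. y \<in> X \<Longrightarrow> ((\<lambda>x. \<pi> x * K x y) has_sum \<pi> y) X"
    using assms by (auto simp: stationary_distribution_on_def)
  show ?case
  proof (rule has_sum_swap_nonneg[where f = "\<lambda>z x. \<pi> x * (K x z * P m z y)"
        and g = "\<lambda>z. \<pi> z * P m z y"])
    show "((\<lambda>x. \<pi> x * (K x z * P m z y)) has_sum \<pi> z * P m z y) X" if "z \<in> X" for z
      using has_sum_cmult_left[OF \<pi>(2)[OF that], of "P m z y"] by (simp add: mult.assoc)
    show "((\<lambda>z. \<pi> x * (K x z * P m z y)) has_sum \<pi> x * P (Suc m) x y) X" if "x \<in> X" for x
      by (rule has_sum_cmult_right[OF P_Suc[OF that]])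
  qed (use Suc \<pi> K_nonneg P_nonneg in auto)
qed

definition H :: "real \<Rightarrow> 'a \<Rightarrow> 'a \<Rightarrow> real" where
  "H t = mat_exp X (\<lambda>x y. - t * (of_bool (x = y) - K x y))"

text \<open>The continuous time chain is the discrete one observed after a Poisson number of steps. All
  terms of this representation are nonnegative, so that from here on sums can be interchanged
  freely.\<close>

lemma H_poisson:
  assumes t: "0 \<le> t" and x: "x \<in> X" and y: "y \<in> X"
  shows "((\<lambda>m. pois t m * P m x y) has_sum H t x y) UNIV"
proof (rule sums_nonneg_imp_has_sum)
  define A where "A = (\<lambda>x y. - t * (of_bool (x = y) - K x y))"
  define G where "G x = Abs_fps (\<lambda>m. t ^ m * P m x y / fact m)" for x
  have "exp_fps X A x y = fps_exp (- t) * G x"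
  proof (rule exp_fps_unique[OF _ _ x])
    fix x m assume x: "x \<in> X"
    have G: "((\<lambda>z. t * (K x z * fps_nth (G z) l)) has_sum fps_nth (fps_deriv (G x)) l) X" for l
    proof -
      have "((\<lambda>z. t * t ^ l / fact l * (K x z * P l z y)) has_sum
          t * t ^ l / fact l * P (Suc l) x y) X"
        by (intro has_sum_cmult_right P_Suc x)
      moreover have "t * t ^ l / fact l * P (Suc l) x y = fps_nth (fps_deriv (G x)) l"
        by (simp add: G_def del: mat_pow.simps of_nat_Suc)
      moreover have "(\<lambda>z. t * t ^ l / fact l * (K x z * P l z y)) = (\<lambda>z. t * (K x z * fps_nth (G z) l))"
        by (auto simp: G_def)
      ultimately show ?thesis by simp
    qed
    let ?e = "fps_exp (- t)"
    have 1: "((\<lambda>z. t * (K x z * fps_nth (?e * G z) m)) has_sum fps_nth (?e * fps_deriv (G x)) m) X"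
    proof -
      have "((\<lambda>z. \<Sum>i=0..m. fps_nth ?e i * (t * (K x z * fps_nth (G z) (m - i)))) has_sum
          (\<Sum>i=0..m. fps_nth ?e i * fps_nth (fps_deriv (G x)) (m - i))) X"
        by (intro has_sum_sum has_sum_cmult_right G)
      then show ?thesis
        by (simp add: fps_mult_nth sum_distrib_left mult.left_commute del: fps_deriv_nth fps_exp_nth)
    qed
    have 2: "((\<lambda>z. - t * (of_bool (x = z) * fps_nth (?e * G z) m)) has_sum
        - t * fps_nth (?e * G x) m) X"
      by (intro has_sum_cmult_right has_sum_delta_mult x)
    have "fps_deriv (?e * G x) = fps_const (- t) * (?e * G x) + ?e * fps_deriv (G x)"
      by (simp add: algebra_simps)
    then have "fps_nth (fps_deriv (?e * G x)) m = - t * fps_nth (?e * G x) m + fps_nth (?e * fps_deriv (G x)) m"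
      by (simp only: fps_add_nth fps_mult_left_const_nth)
    moreover have "(\<lambda>z. A x z * fps_nth (?e * G z) m) =
        (\<lambda>z. - t * (of_bool (x = z) * fps_nth (?e * G z) m) + t * (K x z * fps_nth (?e * G z) m))"
      by (auto simp: A_def algebra_simps)
    ultimately show "((\<lambda>z. A x z * fps_nth (?e * G z) m) has_sum fps_nth (fps_deriv (?e * G x)) m) X"
      using has_sum_add[OF 2 1] by simp
  qed (simp add: G_def)
  moreover have G_radius: "fps_conv_radius (G x) = \<infinity>"
    unfolding fps_conv_radius_def
  proof (rule conv_radius_inftyI'')
    fix z :: real
    have "summable (\<lambda>m. \<bar>t * z\<bar> ^ m / fact m)"
      using summable_exp[of "\<bar>t * z\<bar>"] by (simp add: field_simps)
    then show "summable (\<lambda>m. fps_nth (G x) m * z ^ m)"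
    proof (rule summable_comparison_test')
      fix m :: nat
      have "\<bar>P m x y\<bar> \<le> 1"
        using mat_pow_bound[OF rows_bounded_stochastic[OF stoch] x, of m y] by simp
      then have "\<bar>t * z\<bar> ^ m * \<bar>P m x y\<bar> / fact m \<le> \<bar>t * z\<bar> ^ m * 1 / fact m"
        by (intro divide_right_mono mult_left_mono) auto
      then show "norm (fps_nth (G x) m * z ^ m) \<le> \<bar>t * z\<bar> ^ m / fact m"
        by (simp add: G_def abs_mult power_abs power_mult_distrib mult_ac)
    qed
  qed
  ultimately have H: "H t x y = exp (- t) * eval_fps (G x) 1"
    by (simp add: H_def A_def mat_exp_eq_eval_fps eval_fps_mult)
  have "summable (\<lambda>m. fps_nth (G x) m * 1 ^ m)"
    using G_radius by (intro summable_fps) auto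
  then have "(\<lambda>m. exp (- t) * (fps_nth (G x) m * 1 ^ m)) sums (exp (- t) * eval_fps (G x) 1)"
    unfolding eval_fps_def by (intro sums_mult summable_sums)
  then show "(\<lambda>m. pois t m * P m x y) sums H t x y"
    by (simp add: H pois_def G_def mult.assoc)
qed (use assms pois_nonneg P_nonneg in auto)

lemma H_nonneg:
  assumes "0 \<le> t" "x \<in> X" "y \<in> X"
  shows "0 \<le> H t x y"
  using has_sum_nonneg[OF H_poisson[OF assms]] assms pois_nonneg P_nonneg by auto

lemma H_row:
  assumes t: "0 \<le> t" and x: "x \<in> X"
  shows "(H t x has_sum 1) X"
proof (rule has_sum_swap_nonneg[where f = "\<lambda>m y. pois t m * P m x y" and g = "pois t"])
  show "((\<lambda>y. pois t m * P m x y) has_sum pois t m) X" for m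
    using has_sum_cmult_right[OF P_row[OF x, of m], of "pois t m"] by simp
qed (use t x pois_nonneg P_nonneg pois_has_sum H_poisson in auto)

lemma H_stationary:
  assumes \<pi>: "stationary_distribution_on X K \<pi>" and t: "0 \<le> t" and y: "y \<in> X"
  shows "((\<lambda>x. \<pi> x * H t x y) has_sum \<pi> y) X"
proof (rule has_sum_swap_nonneg[where f = "\<lambda>m x. \<pi> x * (pois t m * P m x y)"
      and g = "\<lambda>m. pois t m * \<pi> y"])
  show "((\<lambda>x. \<pi> x * (pois t m * P m x y)) has_sum pois t m * \<pi> y) X" for m
    using has_sum_cmult_right[OF P_stationary[OF \<pi> y, of m], of "pois t m"]
    by (simp add: mult.left_commute)
  show "((\<lambda>m. pois t m * \<pi> y) has_sum \<pi> y) UNIV"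
    using has_sum_cmult_left[OF pois_has_sum[OF t], of "\<pi> y"] by simp
  show "((\<lambda>m. \<pi> x * (pois t m * P m x y)) has_sum \<pi> x * H t x y) UNIV" if "x \<in> X" for x
    by (rule has_sum_cmult_right[OF H_poisson[OF t that y]])
qed (use \<pi> t y pois_nonneg P_nonneg in \<open>auto simp: stationary_distribution_on_def\<close>)

lemma H_semigroup:
  assumes s: "0 \<le> s" and t: "0 \<le> t" and x: "x \<in> X" and y: "y \<in> X"
  shows "((\<lambda>z. H s x z * H t z y) has_sum H (s + t) x y) X"
proof -
  let ?f = "\<lambda>(m, l). pois s m * pois t l * P (m + l) x y"
  have nonneg: "0 \<le> ?f q" for q
    using s t x y by (auto simp: pois_nonneg P_nonneg split: prod.split)
  have total: "(?f has_sum H (s + t) x y) (UNIV \<times> UNIV)"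
  proof -
    let ?g = "\<lambda>(k, m). pois s m * pois t (k - m) * P k x y"
    have inner: "((\<lambda>m. ?g (k, m)) has_sum pois (s + t) k * P k x y) {..k}" for k
      by (rule has_sum_finiteI) (auto simp: pois_convolution simp flip: sum_distrib_right)
    have outer: "((\<lambda>k. pois (s + t) k * P k x y) has_sum H (s + t) x y) UNIV"
      using s t x y by (intro H_poisson) auto
    have "?g summable_on Sigma UNIV (\<lambda>k. {..k})"
      by (rule summable_on_SigmaI[OF inner has_sum_imp_summable[OF outer]])
        (use s t x y in \<open>auto simp: pois_nonneg P_nonneg\<close>)
    then have "(?g has_sum H (s + t) x y) (Sigma UNIV (\<lambda>k. {..k}))"
      by (rule has_sum_SigmaI[OF inner outer])
    then show ?thesis
      by (subst has_sum_reindex_bij_witness[of _ "\<lambda>(k, m). (m, k - m)" "\<lambda>(m, l). (m + l, m)"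
            "Sigma UNIV (\<lambda>k. {..k})" ?g _ "H (s + t) x y" "H (s + t) x y"]) auto
  qed
  have "((\<lambda>z. H s x z * H t z y) has_sum H (s + t) x y) X"
  proof (rule has_sum_swap_nonneg[where g = ?f
        and f = "\<lambda>(m, l) z. pois s m * pois t l * (P m x z * P l z y)"])
    show "((case q of (m, l) \<Rightarrow> \<lambda>z. pois s m * pois t l * (P m x z * P l z y)) has_sum ?f q) X" for q
      using has_sum_cmult_right[OF P_add[OF x y]] by (auto split: prod.split)
    show "((\<lambda>q. (case q of (m, l) \<Rightarrow> \<lambda>z. pois s m * pois t l * (P m x z * P l z y)) z) has_sum
        H s x z * H t z y) (UNIV \<times> UNIV)" if z: "z \<in> X" for z
    proof -
      let ?h = "\<lambda>(m, l). pois s m * P m x z * (pois t l * P l z y)"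
      have inner: "((\<lambda>l. ?h (m, l)) has_sum pois s m * P m x z * H t z y) UNIV" for m
        using has_sum_cmult_right[OF H_poisson[OF t z y]] by simp
      have outer: "((\<lambda>m. pois s m * P m x z * H t z y) has_sum H s x z * H t z y) UNIV"
        by (rule has_sum_cmult_left[OF H_poisson[OF s x z]])
      have "?h summable_on Sigma UNIV (\<lambda>_. UNIV)"
        by (rule summable_on_SigmaI[OF inner has_sum_imp_summable[OF outer]])
          (use s t x y z in \<open>auto simp: pois_nonneg P_nonneg\<close>)
      then have "(?h has_sum H s x z * H t z y) (Sigma UNIV (\<lambda>_. UNIV))"
        by (rule has_sum_SigmaI[OF inner outer])
      then show ?thesis
        by (simp add: case_prod_unfold mult_ac)
    qed
  qed (use s t x y total in \<open>auto simp: pois_nonneg P_nonneg split: prod.split\<close>)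
  then show ?thesis .
qed

end

section \<open>Overlap of probability distributions\<close>

text \<open>Summed over the state space this is one minus the total variation distance, or the
  Hellinger affinity (one minus the squared Hellinger distance).\<close>

fun overlap :: "dist_kind \<Rightarrow> real \<Rightarrow> real \<Rightarrow> real" where
  "overlap TV a b = min a b"
| "overlap Hellinger a b = sqrt (a * b)"

lemma overlap_nonneg: "0 \<le> a \<Longrightarrow> 0 \<le> b \<Longrightarrow> 0 \<le> overlap D a b"
  by (cases D) auto

lemma overlap_self: "0 \<le> a \<Longrightarrow> overlap D a a = a"
  by (cases D) auto

lemma overlap_zero: "0 \<le> a \<Longrightarrow> overlap D a 0 = 0" "0 \<le> b \<Longrightarrow> overlap D 0 b = 0"
  by (cases D; simp)+

lemma overlap_scale: "0 \<le> c \<Longrightarrow> 0 \<le> a \<Longrightarrow> 0 \<le> b \<Longrightarrow> overlap D (c * a) (c * b) = c * overlap D a b"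
proof (cases D)
  case TV
  then show "0 \<le> c \<Longrightarrow> overlap D (c * a) (c * b) = c * overlap D a b"
    using mult_left_mono[of a b c] mult_left_mono[of b a c] by (auto simp: min_def)
next
  case Hellinger
  have "c * a * (c * b) = c\<^sup>2 * (a * b)" by (simp add: power2_eq_square)
  then show "0 \<le> c \<Longrightarrow> overlap D (c * a) (c * b) = c * overlap D a b"
    using Hellinger by (simp add: real_sqrt_mult)
qed

lemma overlap_mult:
  assumes "0 \<le> a" "0 \<le> b" "0 \<le> a'" "0 \<le> b'"
  shows "overlap D a b * overlap D a' b' \<le> overlap D (a * a') (b * b')"
proof (cases D)
  case TV
  then show ?thesis using assms by (auto intro!: mult_mono)
next
  case Hellinger
  then show ?thesis by (simp add: mult_ac flip: real_sqrt_mult)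
qed

lemma overlap_prod:
  assumes "finite I" "\<And>i. i \<in> I \<Longrightarrow> 0 \<le> f i" "\<And>i. i \<in> I \<Longrightarrow> 0 \<le> g i"
  shows "(\<Prod>i\<in>I. overlap D (f i) (g i)) \<le> overlap D (\<Prod>i\<in>I. f i) (\<Prod>i\<in>I. g i)"
  using assms
proof (induction I)
  case empty
  then show ?case by (simp add: overlap_self)
next
  case (insert i I)
  have "(\<Prod>j\<in>insert i I. overlap D (f j) (g j)) \<le> overlap D (f i) (g i) * overlap D (\<Prod>i\<in>I. f i) (\<Prod>i\<in>I. g i)"
    using insert by (auto intro!: mult_left_mono overlap_nonneg)
  also have "\<dots> \<le> overlap D (f i * (\<Prod>i\<in>I. f i)) (g i * (\<Prod>i\<in>I. g i))"
    using insert by (intro overlap_mult prod_nonneg) auto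
  finally show ?case using insert by simp
qed

text \<open>Concavity: the homogeneous function \<open>overlap D\<close> lies below a supporting plane at \<open>(a, b)\<close>.
  This single property yields both the growth of overlap under merging of points and the
  comparison of a product measure with its marginals.\<close>

lemma overlap_tangent:
  assumes "0 \<le> a" "0 \<le> b"
  obtains \<alpha> \<beta> where "0 \<le> \<alpha>" "0 \<le> \<beta>" "\<alpha> + \<beta> = overlap D a b"
    "\<And>u v. 0 \<le> u \<Longrightarrow> 0 \<le> v \<Longrightarrow> overlap D (a * u) (b * v) \<le> \<alpha> * u + \<beta> * v"
proof (cases D)
  case TV
  show ?thesis
  proof (cases "a \<le> b")
    case True
    then show ?thesis using that[of a 0] TV assms by auto
  next
    case False
    then show ?thesis using that[of 0 b] TV assms by auto
  qed
next
  case Hellinger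
  have "sqrt (a * u * (b * v)) \<le> sqrt (a * b) / 2 * u + sqrt (a * b) / 2 * v" if "0 \<le> u" "0 \<le> v" for u v
  proof -
    have "sqrt (a * u * (b * v)) = sqrt (a * b) * sqrt (u * v)"
      by (simp add: mult_ac flip: real_sqrt_mult)
    also have "\<dots> \<le> sqrt (a * b) * ((u + v) / 2)"
      using assms that by (intro mult_left_mono arith_geo_mean_sqrt) auto
    finally show ?thesis by (simp add: field_simps)
  qed
  then show ?thesis
    using that[of "sqrt (a * b) / 2" "sqrt (a * b) / 2"] Hellinger assms by auto
qed

lemma overlap_le_mean:
  assumes "0 \<le> a" "0 \<le> b"
  shows "2 * overlap D a b \<le> a + b"
  using arith_geo_mean_sqrt[of a b] assms by (cases D) auto

lemma overlap_summable:
  assumes "(\<mu> has_sum A) X" "(\<nu> has_sum B) X"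
    "\<And>x. x \<in> X \<Longrightarrow> 0 \<le> \<mu> x" "\<And>x. x \<in> X \<Longrightarrow> 0 \<le> \<nu> x"
  shows "(\<lambda>x. overlap D (\<mu> x) (\<nu> x)) summable_on X"
proof (rule summable_on_comparison_test[OF has_sum_imp_summable[OF has_sum_add[OF assms(1,2)]]])
  fix x assume "x \<in> X"
  then show "overlap D (\<mu> x) (\<nu> x) \<le> \<mu> x + \<nu> x" "0 \<le> overlap D (\<mu> x) (\<nu> x)"
    using overlap_le_mean[of "\<mu> x" "\<nu> x" D] overlap_nonneg[of "\<mu> x" "\<nu> x" D] assms by auto
qed

text \<open>Merging points can only increase the overlap: the tangent at the totals \<open>(A, B)\<close> bounds
  every term, and the bounds add up to the value at \<open>(A, B)\<close>. For the Hellinger overlap this is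
  the Cauchy-Schwarz inequality.\<close>

lemma infsum_overlap_le:
  assumes A: "(\<mu> has_sum A) X" and B: "(\<nu> has_sum B) X"
    and \<mu>: "\<And>x. x \<in> X \<Longrightarrow> 0 \<le> \<mu> x" and \<nu>: "\<And>x. x \<in> X \<Longrightarrow> 0 \<le> \<nu> x"
  shows "(\<Sum>\<^sub>\<infinity>x\<in>X. overlap D (\<mu> x) (\<nu> x)) \<le> overlap D A B"
proof -
  have AB: "0 \<le> A" "0 \<le> B"
    using has_sum_nonneg[OF A] has_sum_nonneg[OF B] \<mu> \<nu> by auto
  show ?thesis
  proof (cases "A = 0 \<or> B = 0")
    case True
    have "\<mu> x = 0 \<or> \<nu> x = 0" if "x \<in> X" for x
      using True nonneg_has_sum_le_0D[OF A] nonneg_has_sum_le_0D[OF B] \<mu> \<nu> that by auto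
    then have "overlap D (\<mu> x) (\<nu> x) = 0" if "x \<in> X" for x
      using \<mu>[OF that] \<nu>[OF that] that by (metis overlap_zero)
    then have "(\<Sum>\<^sub>\<infinity>x\<in>X. overlap D (\<mu> x) (\<nu> x)) = 0"
      by (intro infsum_0) auto
    then show ?thesis using AB by (simp add: overlap_nonneg)
  next
    case False
    with AB have pos: "0 < A" "0 < B" by auto
    obtain \<alpha> \<beta> where ab: "\<alpha> + \<beta> = overlap D A B"
      "\<And>u v. 0 \<le> u \<Longrightarrow> 0 \<le> v \<Longrightarrow> overlap D (A * u) (B * v) \<le> \<alpha> * u + \<beta> * v"
      using overlap_tangent[OF AB, of D] by metis
    have "((\<lambda>x. \<alpha> / A * \<mu> x + \<beta> / B * \<nu> x) has_sum \<alpha> / A * A + \<beta> / B * B) X"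
      by (intro has_sum_add has_sum_cmult_right A B)
    then have *: "((\<lambda>x. \<alpha> / A * \<mu> x + \<beta> / B * \<nu> x) has_sum \<alpha> + \<beta>) X"
      using pos by simp
    have "overlap D (\<mu> x) (\<nu> x) \<le> \<alpha> / A * \<mu> x + \<beta> / B * \<nu> x" if "x \<in> X" for x
      using ab(2)[of "\<mu> x / A" "\<nu> x / B"] pos \<mu>[OF that] \<nu>[OF that] by simp
    then show ?thesis
      using has_sum_mono[OF has_sum_infsum[OF overlap_summable[OF A B \<mu> \<nu>]] *] ab(1) by simp
  qed
qed

lemma cauchy_schwarz_infsum:
  assumes "(u has_sum U) X" "(v has_sum V) X"
    "\<And>x. x \<in> X \<Longrightarrow> 0 \<le> u x" "\<And>x. x \<in> X \<Longrightarrow> 0 \<le> v x"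
  shows "(\<lambda>x. sqrt (u x * v x)) summable_on X" "(\<Sum>\<^sub>\<infinity>x\<in>X. sqrt (u x * v x)) \<le> sqrt (U * V)"
  using overlap_summable[OF assms, of Hellinger] infsum_overlap_le[OF assms, of Hellinger] by simp_all

text \<open>The lower bound is supermultiplicativity of the overlap at every point. For the upper
  bound, the tangent at the values of the \<open>i\<close>th marginals bounds the overlap by a combination of
  the remaining product measures, which sum to one.\<close>

lemma overlap_product_bounds:
  fixes \<mu> \<nu> :: "'i \<Rightarrow> 'a \<Rightarrow> real"
  assumes fin: "finite I"
    and \<mu>: "\<And>i x. i \<in> I \<Longrightarrow> x \<in> X i \<Longrightarrow> 0 \<le> \<mu> i x" "\<And>i. i \<in> I \<Longrightarrow> (\<mu> i has_sum 1) (X i)"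
    and \<nu>: "\<And>i x. i \<in> I \<Longrightarrow> x \<in> X i \<Longrightarrow> 0 \<le> \<nu> i x" "\<And>i. i \<in> I \<Longrightarrow> (\<nu> i has_sum 1) (X i)"
  defines "M \<equiv> \<lambda>y. \<Prod>i\<in>I. \<mu> i (y i)" and "N \<equiv> \<lambda>y. \<Prod>i\<in>I. \<nu> i (y i)"
  shows "(\<Prod>i\<in>I. \<Sum>\<^sub>\<infinity>x\<in>X i. overlap D (\<mu> i x) (\<nu> i x)) \<le> (\<Sum>\<^sub>\<infinity>y\<in>PiE I X. overlap D (M y) (N y))"
    and "i \<in> I \<Longrightarrow> (\<Sum>\<^sub>\<infinity>y\<in>PiE I X. overlap D (M y) (N y)) \<le> (\<Sum>\<^sub>\<infinity>x\<in>X i. overlap D (\<mu> i x) (\<nu> i x))"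
proof -
  have M: "(M has_sum 1) (PiE I X)" and N: "(N has_sum 1) (PiE I X)"
    using has_sum_prod_PiE_nonneg[OF fin \<mu>] has_sum_prod_PiE_nonneg[OF fin \<nu>]
    by (simp_all add: M_def N_def)
  have nn: "0 \<le> M y" "0 \<le> N y" if "y \<in> PiE I X" for y
    using PiE_mem[OF that] \<mu>(1) \<nu>(1) by (auto simp: M_def N_def intro!: prod_nonneg)
  have MN: "((\<lambda>y. overlap D (M y) (N y)) has_sum (\<Sum>\<^sub>\<infinity>y\<in>PiE I X. overlap D (M y) (N y))) (PiE I X)"
    using overlap_summable[OF M N nn] by auto
  have s: "(\<lambda>x. overlap D (\<mu> i x) (\<nu> i x)) summable_on X i" if "i \<in> I" for i
    using overlap_summable[OF \<mu>(2)[OF that] \<nu>(2)[OF that] \<mu>(1)[OF that] \<nu>(1)[OF that]] .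
  show "(\<Prod>i\<in>I. \<Sum>\<^sub>\<infinity>x\<in>X i. overlap D (\<mu> i x) (\<nu> i x)) \<le> (\<Sum>\<^sub>\<infinity>y\<in>PiE I X. overlap D (M y) (N y))"
  proof (rule has_sum_mono[OF _ MN])
    show "((\<lambda>y. \<Prod>i\<in>I. overlap D (\<mu> i (y i)) (\<nu> i (y i))) has_sum
        (\<Prod>i\<in>I. \<Sum>\<^sub>\<infinity>x\<in>X i. overlap D (\<mu> i x) (\<nu> i x))) (PiE I X)"
      using s \<mu>(1) \<nu>(1) by (intro has_sum_prod_PiE_nonneg fin overlap_nonneg has_sum_infsum) auto
    show "(\<Prod>i\<in>I. overlap D (\<mu> i (y i)) (\<nu> i (y i))) \<le> overlap D (M y) (N y)" if "y \<in> PiE I X" for y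
      unfolding M_def N_def using PiE_mem[OF that] \<mu>(1) \<nu>(1) by (intro overlap_prod fin) auto
  qed
  show "(\<Sum>\<^sub>\<infinity>y\<in>PiE I X. overlap D (M y) (N y)) \<le> (\<Sum>\<^sub>\<infinity>x\<in>X i. overlap D (\<mu> i x) (\<nu> i x))" if i: "i \<in> I"
  proof -
    have "\<exists>\<alpha> \<beta>. 0 \<le> \<alpha> \<and> 0 \<le> \<beta> \<and> \<alpha> + \<beta> = overlap D (\<mu> i a) (\<nu> i a) \<and>
        (\<forall>u v. 0 \<le> u \<longrightarrow> 0 \<le> v \<longrightarrow> overlap D (\<mu> i a * u) (\<nu> i a * v) \<le> \<alpha> * u + \<beta> * v)" if "a \<in> X i" for a
      using overlap_tangent[OF \<mu>(1)[OF i that] \<nu>(1)[OF i that], of D] by metis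
    then obtain \<alpha> \<beta> where ab: "\<And>a. a \<in> X i \<Longrightarrow> 0 \<le> \<alpha> a" "\<And>a. a \<in> X i \<Longrightarrow> 0 \<le> \<beta> a"
      "\<And>a. a \<in> X i \<Longrightarrow> \<alpha> a + \<beta> a = overlap D (\<mu> i a) (\<nu> i a)"
      "\<And>a u v. a \<in> X i \<Longrightarrow> 0 \<le> u \<Longrightarrow> 0 \<le> v \<Longrightarrow> overlap D (\<mu> i a * u) (\<nu> i a * v) \<le> \<alpha> a * u + \<beta> a * v"
      by metis
    have \<alpha>: "\<alpha> summable_on X i"
      by (rule summable_on_comparison_test[OF s[OF i]]) (use ab(1-3) in fastforce)+
    have \<beta>: "\<beta> summable_on X i"
      by (rule summable_on_comparison_test[OF s[OF i]]) (use ab(1-3) in fastforce)+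
    have marg: "((\<lambda>y. g (y i) * (\<Prod>j\<in>I - {i}. \<kappa> j (y j))) has_sum infsum g (X i)) (PiE I X)"
      if g: "\<And>a. a \<in> X i \<Longrightarrow> 0 \<le> g a" "g summable_on X i"
        and \<kappa>: "\<And>i x. i \<in> I \<Longrightarrow> x \<in> X i \<Longrightarrow> 0 \<le> \<kappa> i x" "\<And>i. i \<in> I \<Longrightarrow> (\<kappa> i has_sum 1) (X i)"
      for g and \<kappa> :: "'i \<Rightarrow> 'a \<Rightarrow> real"
    proof -
      have "((\<lambda>y. \<Prod>j\<in>I. (if j = i then g else \<kappa> j) (y j)) has_sum
          (\<Prod>j\<in>I. if j = i then infsum g (X i) else 1)) (PiE I X)"
        using g \<kappa> by (intro has_sum_prod_PiE_nonneg fin) auto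
      moreover have "(\<Prod>j\<in>I. if j = i then infsum g (X i) else 1) = infsum g (X i)"
        using fin i by simp
      moreover have "(\<lambda>y. \<Prod>j\<in>I. (if j = i then g else \<kappa> j) (y j)) = (\<lambda>y. g (y i) * (\<Prod>j\<in>I - {i}. \<kappa> j (y j)))"
        by (rule ext, subst prod.remove[OF fin i]) (auto intro!: prod.cong)
      ultimately show ?thesis by simp
    qed
    have "((\<lambda>y. \<alpha> (y i) * (\<Prod>j\<in>I - {i}. \<mu> j (y j)) + \<beta> (y i) * (\<Prod>j\<in>I - {i}. \<nu> j (y j)))
        has_sum (infsum \<alpha> (X i) + infsum \<beta> (X i))) (PiE I X)"
      using ab(1,2) \<alpha> \<beta> by (intro has_sum_add marg \<mu> \<nu>) auto
    moreover have "overlap D (M y) (N y) \<le>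
        \<alpha> (y i) * (\<Prod>j\<in>I - {i}. \<mu> j (y j)) + \<beta> (y i) * (\<Prod>j\<in>I - {i}. \<nu> j (y j))"
      if y: "y \<in> PiE I X" for y
      unfolding M_def N_def prod.remove[OF fin i]
      using i PiE_mem[OF y] \<mu>(1) \<nu>(1) by (intro ab(4) prod_nonneg) auto
    ultimately have "(\<Sum>\<^sub>\<infinity>y\<in>PiE I X. overlap D (M y) (N y)) \<le> infsum \<alpha> (X i) + infsum \<beta> (X i)"
      by (rule has_sum_mono[OF MN])
    also have "\<dots> = (\<Sum>\<^sub>\<infinity>x\<in>X i. overlap D (\<mu> i x) (\<nu> i x))"
      using ab(3) by (simp add: infsum_add[OF \<alpha> \<beta>, symmetric] cong: infsum_cong)
    finally show ?thesis .
  qed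
qed

text \<open>The contribution of a point to twice the distance to the power \<open>rho D\<close>:
  \<open>\<bar>a - b\<bar>\<close> for total variation and \<open>(sqrt a - sqrt b)\<^sup>2\<close> for the Hellinger distance.\<close>

definition discrepancy :: "dist_kind \<Rightarrow> real \<Rightarrow> real \<Rightarrow> real" where
  "discrepancy D a b = a + b - 2 * overlap D a b"

lemma discrepancy_TV: "discrepancy TV a b = \<bar>a - b\<bar>"
  by (auto simp: discrepancy_def min_def)

lemma discrepancy_Hellinger: "0 \<le> a \<Longrightarrow> 0 \<le> b \<Longrightarrow> discrepancy Hellinger a b = (sqrt a - sqrt b)\<^sup>2"
  by (simp add: discrepancy_def power2_diff real_sqrt_mult)

lemma discrepancy_nonneg: "0 \<le> a \<Longrightarrow> 0 \<le> b \<Longrightarrow> 0 \<le> discrepancy D a b"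
  using overlap_le_mean[of a b D] by (simp add: discrepancy_def)

lemma discrepancy_has_sum:
  assumes "(\<mu> has_sum 1) X" "(\<nu> has_sum 1) X"
    "\<And>x. x \<in> X \<Longrightarrow> 0 \<le> \<mu> x" "\<And>x. x \<in> X \<Longrightarrow> 0 \<le> \<nu> x"
  shows "((\<lambda>x. discrepancy D (\<mu> x) (\<nu> x)) has_sum 2 * (1 - (\<Sum>\<^sub>\<infinity>x\<in>X. overlap D (\<mu> x) (\<nu> x)))) X"
proof -
  have "((\<lambda>x. \<mu> x + \<nu> x - 2 * overlap D (\<mu> x) (\<nu> x)) has_sum
      1 + 1 - 2 * (\<Sum>\<^sub>\<infinity>x\<in>X. overlap D (\<mu> x) (\<nu> x))) X"
    by (intro has_sum_diff has_sum_add has_sum_cmult_right has_sum_infsum overlap_summable[OF assms] assms)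
  then show ?thesis by (simp add: discrepancy_def)
qed

text \<open>As \<open>a - p\<close> sums to zero, \<open>h - c\<close> is the sum of \<open>(a z - p z) * (b z - c)\<close>.\<close>

lemma discrepancy_mixture_TV:
  assumes a: "(a has_sum 1) Z" and p: "(p has_sum 1) Z"
    and h: "((\<lambda>z. a z * b z) has_sum h) Z" and c: "((\<lambda>z. p z * b z) has_sum c) Z"
    and s: "(\<lambda>z. discrepancy TV (a z) (p z) * discrepancy TV (b z) c) summable_on Z"
  shows "discrepancy TV h c \<le> (\<Sum>\<^sub>\<infinity>z\<in>Z. discrepancy TV (a z) (p z) * discrepancy TV (b z) c)"
proof -
  have "((\<lambda>z. (a z * b z - p z * b z) - (a z - p z) * c) has_sum (h - c) - (1 - 1) * c) Z"
    by (intro has_sum_diff has_sum_cmult_left a p h c)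
  moreover have "(\<lambda>z. (a z * b z - p z * b z) - (a z - p z) * c) = (\<lambda>z. (a z - p z) * (b z - c))"
    by (auto simp: algebra_simps)
  ultimately have *: "((\<lambda>z. (a z - p z) * (b z - c)) has_sum h - c) Z"
    by simp
  have "(\<lambda>z. norm ((a z - p z) * (b z - c))) summable_on Z"
    using s by (simp add: discrepancy_TV abs_mult)
  from norm_infsum_bound[OF this] show ?thesis
    using infsumI[OF *] by (simp add: discrepancy_TV abs_mult)
qed

text \<open>Again \<open>h - c\<close> is the sum of \<open>(a z - p z) * (b z - c)\<close>. Splitting each factor as a
  difference of squares and applying the Cauchy-Schwarz inequality bounds \<open>(h - c)\<^sup>2\<close> by the sum
  of the products of discrepancies times the sum of
  \<open>Q z = (sqrt (a z) + sqrt (p z))\<^sup>2 * (sqrt (b z) + sqrt c)\<^sup>2\<close>. The latter is at most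
  \<open>8 * (sqrt h + sqrt c)\<^sup>2\<close>, and dividing by \<open>(sqrt h + sqrt c)\<^sup>2\<close> leaves the claim. The constant
  matters: it gives the factor \<open>2 * rho D = 4\<close> in the submultiplicativity of the Hellinger
  distance. Bounding \<open>(sqrt x + sqrt y)\<^sup>2\<close> by \<open>2 * (x + y)\<close> before summing would only give \<open>12\<close>
  instead of \<open>8\<close>, so \<open>Q\<close> is expanded and each of its nine terms is summed on its own.\<close>

lemma discrepancy_mixture_Hellinger:
  assumes nn: "\<And>z. z \<in> Z \<Longrightarrow> 0 \<le> a z" "\<And>z. z \<in> Z \<Longrightarrow> 0 \<le> p z" "\<And>z. z \<in> Z \<Longrightarrow> 0 \<le> b z"
    and a: "(a has_sum 1) Z" and p: "(p has_sum 1) Z"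
    and h: "((\<lambda>z. a z * b z) has_sum h) Z" and c: "((\<lambda>z. p z * b z) has_sum c) Z"
    and s: "(\<lambda>z. discrepancy Hellinger (a z) (p z) * discrepancy Hellinger (b z) c) summable_on Z"
  shows "discrepancy Hellinger h c \<le> 8 * (\<Sum>\<^sub>\<infinity>z\<in>Z. discrepancy Hellinger (a z) (p z) * discrepancy Hellinger (b z) c)"
proof -
  define S where "S = (\<Sum>\<^sub>\<infinity>z\<in>Z. discrepancy Hellinger (a z) (p z) * discrepancy Hellinger (b z) c)"
  have h0: "0 \<le> h" and c0: "0 \<le> c"
    using has_sum_nonneg[OF h] has_sum_nonneg[OF c] nn by auto
  define u v where "u = sqrt h" and "v = sqrt c"
  have uv: "0 \<le> u" "0 \<le> v" "h = u\<^sup>2" "c = v\<^sup>2"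
    using h0 c0 by (auto simp: u_def v_def)
  define Q where "Q z = (sqrt (a z) + sqrt (p z))\<^sup>2 * (sqrt (b z) + v)\<^sup>2" for z
  have ab: "0 \<le> a z * b z" and pb: "0 \<le> p z * b z" if "z \<in> Z" for z
    using nn that by auto
  have sq: "(\<lambda>z. sqrt (a z * b z * (p z * b z))) summable_on Z"
      "(\<Sum>\<^sub>\<infinity>z\<in>Z. sqrt (a z * b z * (p z * b z))) \<le> u * v"
      "(\<lambda>z. sqrt (a z * p z)) summable_on Z" "(\<Sum>\<^sub>\<infinity>z\<in>Z. sqrt (a z * p z)) \<le> 1"
      "(\<lambda>z. sqrt (a z * (a z * b z))) summable_on Z" "(\<Sum>\<^sub>\<infinity>z\<in>Z. sqrt (a z * (a z * b z))) \<le> u"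
      "(\<lambda>z. sqrt (p z * (p z * b z))) summable_on Z" "(\<Sum>\<^sub>\<infinity>z\<in>Z. sqrt (p z * (p z * b z))) \<le> v"
      "(\<lambda>z. sqrt (a z * b z * p z)) summable_on Z" "(\<Sum>\<^sub>\<infinity>z\<in>Z. sqrt (a z * b z * p z)) \<le> u"
    using cauchy_schwarz_infsum[OF h c ab pb] cauchy_schwarz_infsum[OF a p nn(1,2)]
      cauchy_schwarz_infsum[OF a h nn(1) ab] cauchy_schwarz_infsum[OF p c nn(2) pb]
      cauchy_schwarz_infsum[OF h p ab nn(2)] by (simp_all add: u_def v_def real_sqrt_mult)
  define I1 I2 I3 I4 I5 where
    "I1 = (\<Sum>\<^sub>\<infinity>z\<in>Z. sqrt (a z * b z * (p z * b z)))" and "I2 = (\<Sum>\<^sub>\<infinity>z\<in>Z. sqrt (a z * p z))" and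
    "I3 = (\<Sum>\<^sub>\<infinity>z\<in>Z. sqrt (a z * (a z * b z)))" and "I4 = (\<Sum>\<^sub>\<infinity>z\<in>Z. sqrt (p z * (p z * b z)))" and
    "I5 = (\<Sum>\<^sub>\<infinity>z\<in>Z. sqrt (a z * b z * p z))"
  have "((\<lambda>z. a z * b z + (a z * c + (p z * b z + (p z * c + (2 * sqrt (a z * b z * (p z * b z))
      + (2 * c * sqrt (a z * p z) + (2 * v * sqrt (a z * (a z * b z)) + (2 * v * sqrt (p z * (p z * b z))
      + 4 * v * sqrt (a z * b z * p z))))))))) has_sum
      h + (1 * c + (c + (1 * c + (2 * I1 + (2 * c * I2 + (2 * v * I3 + (2 * v * I4 + 4 * v * I5)))))))) Z"
    unfolding I1_def I2_def I3_def I4_def I5_def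
    by (intro has_sum_add has_sum_cmult_right has_sum_cmult_left has_sum_infsum sq a p h c)
  moreover have "a z * b z + (a z * c + (p z * b z + (p z * c + (2 * sqrt (a z * b z * (p z * b z))
      + (2 * c * sqrt (a z * p z) + (2 * v * sqrt (a z * (a z * b z)) + (2 * v * sqrt (p z * (p z * b z))
      + 4 * v * sqrt (a z * b z * p z)))))))) = Q z" if "z \<in> Z" for z
  proof -
    have "0 \<le> a z" "0 \<le> p z" "0 \<le> b z"
      using nn that by auto
    then obtain x y w where xyw: "0 \<le> x" "0 \<le> y" "0 \<le> w" "a z = x\<^sup>2" "p z = y\<^sup>2" "b z = w\<^sup>2"
      by (metis real_sqrt_ge_zero real_sqrt_pow2)
    then show ?thesis
      by (simp add: Q_def real_sqrt_mult uv(4) power2_eq_square algebra_simps)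
  qed
  ultimately have Q: "(Q has_sum
      h + (1 * c + (c + (1 * c + (2 * I1 + (2 * c * I2 + (2 * v * I3 + (2 * v * I4 + 4 * v * I5)))))))) Z"
    (is "(_ has_sum ?q) _") by (subst (asm) has_sum_cong[where g = Q]) auto
  have "?q \<le> u\<^sup>2 + (v\<^sup>2 + (v\<^sup>2 + (v\<^sup>2 + (2 * (u * v) + (2 * v\<^sup>2 * 1 + (2 * v * u + (2 * v * v + 4 * v * u)))))))"
    unfolding uv using sq uv(1,2)
    by (intro add_mono mult_left_mono) (auto simp: I1_def I2_def I3_def I4_def I5_def)
  also have "\<dots> \<le> 8 * (u + v)\<^sup>2"
    using uv(1,2) by (simp add: power2_eq_square algebra_simps)
  finally have q: "?q \<le> 8 * (u + v)\<^sup>2" .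
  have dab: "discrepancy Hellinger (a z) (p z) * discrepancy Hellinger (b z) c = (sqrt (a z) - sqrt (p z))\<^sup>2 * (sqrt (b z) - v)\<^sup>2"
    if "z \<in> Z" for z
    using nn that c0 by (simp add: discrepancy_Hellinger v_def)
  have dnn: "0 \<le> discrepancy Hellinger (a z) (p z) * discrepancy Hellinger (b z) c" if "z \<in> Z" for z
    using nn that c0 by (intro mult_nonneg_nonneg discrepancy_nonneg) auto
  have root: "sqrt (discrepancy Hellinger (a z) (p z) * discrepancy Hellinger (b z) c * Q z) = \<bar>a z - p z\<bar> * \<bar>b z - c\<bar>"
    if "z \<in> Z" for z
  proof -
    have "0 \<le> a z" "0 \<le> p z" "0 \<le> b z"
      using nn that by auto
    then obtain x y w where xyw: "0 \<le> x" "0 \<le> y" "0 \<le> w" "a z = x\<^sup>2" "p z = y\<^sup>2" "b z = w\<^sup>2"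
      by (metis real_sqrt_ge_zero real_sqrt_pow2)
    have "discrepancy Hellinger (a z) (p z) * discrepancy Hellinger (b z) c * Q z = ((a z - p z) * (b z - c))\<^sup>2"
      unfolding dab[OF that] Q_def using xyw by (simp add: uv(4) power2_eq_square algebra_simps)
    then show ?thesis by (simp add: abs_mult)
  qed
  have Qnn: "0 \<le> Q z" for z by (simp add: Q_def)
  have S: "((\<lambda>z. discrepancy Hellinger (a z) (p z) * discrepancy Hellinger (b z) c) has_sum S) Z"
    using s by (simp add: S_def)
  have "discrepancy TV h c \<le> (\<Sum>\<^sub>\<infinity>z\<in>Z. discrepancy TV (a z) (p z) * discrepancy TV (b z) c)"
    using cauchy_schwarz_infsum(1)[OF S Q dnn Qnn] root
    by (intro discrepancy_mixture_TV a p h c) (simp add: discrepancy_TV cong: summable_on_cong)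
  also have "\<dots> \<le> sqrt (S * ?q)"
    using cauchy_schwarz_infsum(2)[OF S Q dnn Qnn] root by (simp add: discrepancy_TV cong: infsum_cong)
  also have "\<dots> \<le> sqrt (S * (8 * (u + v)\<^sup>2))"
    using q has_sum_nonneg[OF S dnn] by (intro real_sqrt_le_mono mult_left_mono) auto
  finally have "\<bar>h - c\<bar> \<le> sqrt (8 * S) * (u + v)"
    using uv(1,2) by (simp add: discrepancy_TV real_sqrt_mult mult_ac)
  moreover have "\<bar>h - c\<bar> = \<bar>u - v\<bar> * (u + v)"
    using uv(1,2) by (simp add: uv(3,4) square_diff_square_factored power2_eq_square abs_mult)
  ultimately have "\<bar>u - v\<bar> \<le> sqrt (8 * S)"
    using uv(1,2) has_sum_nonneg[OF S dnn]
    by (cases "u + v = 0") (auto simp: add_nonneg_eq_0_iff)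
  then have "\<bar>u - v\<bar>\<^sup>2 \<le> (sqrt (8 * S))\<^sup>2"
    by (intro power_mono) auto
  then show ?thesis
    using has_sum_nonneg[OF S dnn] h0 c0 by (simp add: discrepancy_Hellinger u_def v_def S_def)
qed

text \<open>The value \<open>(2 * rho D) powr rho D / 2\<close> is the constant \<open>1\<close> or \<open>8\<close> of the two cases.\<close>

lemma discrepancy_mixture:
  assumes nn: "\<And>z. z \<in> Z \<Longrightarrow> 0 \<le> a z" "\<And>z. z \<in> Z \<Longrightarrow> 0 \<le> p z" "\<And>z. z \<in> Z \<Longrightarrow> 0 \<le> b z"
    and "(a has_sum 1) Z" "(p has_sum 1) Z"
    and "((\<lambda>z. a z * b z) has_sum h) Z" "((\<lambda>z. p z * b z) has_sum c) Z"
    and "(\<lambda>z. discrepancy D (a z) (p z) * discrepancy D (b z) c) summable_on Z"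
  shows "2 * discrepancy D h c \<le> (2 * rho D) powr rho D * (\<Sum>\<^sub>\<infinity>z\<in>Z. discrepancy D (a z) (p z) * discrepancy D (b z) c)"
  using discrepancy_mixture_TV[of a Z p b h c] discrepancy_mixture_Hellinger[of Z a p b h c] assms
  by (cases D) auto

section \<open>Distance to stationarity\<close>

definition similarity :: "dist_kind \<Rightarrow> 'a mchain \<Rightarrow> real \<Rightarrow> 'a \<Rightarrow> real" where
  "similarity D C t x = (\<Sum>\<^sub>\<infinity>y\<in>states C. overlap D (heat_kernel C t x y) (stat C y))"

text \<open>What the distance at a single time requires of a chain. Products are shown to have this
  property directly from their heat kernel.\<close>

definition markov_at :: "'a mchain \<Rightarrow> real \<Rightarrow> bool" where
  "markov_at C t \<longleftrightarrow> states C \<noteq> {} \<and>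
     (\<forall>x\<in>states C. (\<forall>y\<in>states C. 0 \<le> heat_kernel C t x y) \<and> (heat_kernel C t x has_sum 1) (states C)) \<and>
     (\<forall>y\<in>states C. 0 \<le> stat C y) \<and> (stat C has_sum 1) (states C)"

lemma rho_pos: "0 < rho D"
  by (cases D) auto

lemma powr_le_cancel_iff_nonneg:
  fixes a x y :: real
  assumes "0 < a" "0 \<le> x" "0 \<le> y"
  shows "x powr a \<le> y powr a \<longleftrightarrow> x \<le> y"
  using assms powr_mono2[of a x y] powr_less_mono2[of a y x] by force

text \<open>The supremum over events is attained at the set where \<open>\<mu>\<close> dominates \<open>\<nu>\<close>.\<close>

lemma total_variation_overlap:
  assumes \<mu>: "(\<mu> has_sum 1) X" and \<nu>: "(\<nu> has_sum 1) X"
    and nn: "\<And>x. x \<in> X \<Longrightarrow> 0 \<le> \<mu> x" "\<And>x. x \<in> X \<Longrightarrow> 0 \<le> \<nu> x"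
  defines "o1 \<equiv> 1 - (\<Sum>\<^sub>\<infinity>x\<in>X. overlap TV (\<mu> x) (\<nu> x))"
  shows "A \<subseteq> X \<Longrightarrow> infsum \<mu> A - infsum \<nu> A \<le> o1"
    and "\<exists>A\<subseteq>X. infsum \<mu> A - infsum \<nu> A = o1"
proof -
  have diff: "((\<lambda>x. \<mu> x - \<nu> x) has_sum (infsum \<mu> A - infsum \<nu> A)) A" if "A \<subseteq> X" for A
    using summable_on_subset_banach[OF has_sum_imp_summable[OF \<mu>] that]
      summable_on_subset_banach[OF has_sum_imp_summable[OF \<nu>] that]
    by (intro has_sum_diff has_sum_infsum)
  have pos: "((\<lambda>x. \<mu> x - overlap TV (\<mu> x) (\<nu> x)) has_sum o1) X"
    unfolding o1_def by (intro has_sum_diff \<mu> has_sum_infsum overlap_summable[OF \<mu> \<nu> nn])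
  show "infsum \<mu> A - infsum \<nu> A \<le> o1" if "A \<subseteq> X"
    by (rule has_sum_mono_neutral[OF diff[OF that] pos]) (use that in auto)
  define A where "A = {x \<in> X. \<nu> x \<le> \<mu> x}"
  have "((\<lambda>x. \<mu> x - \<nu> x) has_sum o1) A"
    using pos by (rule has_sum_cong_neutral[THEN iffD1, rotated 3]) (auto simp: A_def)
  then have "infsum \<mu> A - infsum \<nu> A = o1"
    using diff[of A] has_sum_unique by (auto simp: A_def)
  then show "\<exists>A\<subseteq>X. infsum \<mu> A - infsum \<nu> A = o1"
    by (metis (no_types, lifting) A_def mem_Collect_eq subsetI)
qed

context
  fixes C :: "'a mchain" and t :: real
  assumes C: "markov_at C t"
begin

lemma markov_atD:
  "states C \<noteq> {}"
  "x \<in> states C \<Longrightarrow> y \<in> states C \<Longrightarrow> 0 \<le> heat_kernel C t x y"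
  "x \<in> states C \<Longrightarrow> (heat_kernel C t x has_sum 1) (states C)"
  "y \<in> states C \<Longrightarrow> 0 \<le> stat C y"
  "(stat C has_sum 1) (states C)"
  using C by (auto simp: markov_at_def)

lemma similarity_summable:
  "x \<in> states C \<Longrightarrow> (\<lambda>y. overlap D (heat_kernel C t x y) (stat C y)) summable_on states C"
  using markov_atD by (intro overlap_summable[where A = 1 and B = 1]) auto

lemma similarity_bounds:
  assumes "x \<in> states C"
  shows "0 \<le> similarity D C t x" "similarity D C t x \<le> 1"
  using infsum_overlap_le[where \<mu> = "heat_kernel C t x" and A = 1 and X = "states C" and \<nu> = "stat C"
      and B = 1 and D = D] markov_atD assms
  by (auto simp: similarity_def overlap_self intro!: infsum_nonneg overlap_nonneg)

lemma discrepancy_similarity: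
  assumes "x \<in> states C"
  shows "((\<lambda>y. discrepancy D (heat_kernel C t x y) (stat C y)) has_sum 2 * (1 - similarity D C t x)) (states C)"
  unfolding similarity_def using markov_atD assms by (intro discrepancy_has_sum) auto

text \<open>The last two claims say that the distance to the power \<open>rho D\<close> is the supremum of
  \<open>1 - similarity D C t x\<close> over \<open>x\<close>.\<close>

lemma chain_dist_overlap:
  shows "0 \<le> chain_dist D C t"
    and "x \<in> states C \<Longrightarrow> 1 - similarity D C t x \<le> chain_dist D C t powr rho D"
    and "(\<And>x. x \<in> states C \<Longrightarrow> 1 - similarity D C t x \<le> c) \<Longrightarrow> chain_dist D C t powr rho D \<le> c"
proof -
  obtain x0 where x0: "x0 \<in> states C" using markov_atD by blast
  have "0 \<le> chain_dist D C t \<and> (\<forall>x\<in>states C. 1 - similarity D C t x \<le> chain_dist D C t powr rho D) \<and>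
    (\<forall>c. (\<forall>x\<in>states C. 1 - similarity D C t x \<le> c) \<longrightarrow> chain_dist D C t powr rho D \<le> c)"
  proof (cases D)
    case TV
    let ?S = "{(\<Sum>\<^sub>\<infinity>y\<in>A. heat_kernel C t x y) - (\<Sum>\<^sub>\<infinity>y\<in>A. stat C y) | x A.
       x \<in> states C \<and> A \<subseteq> states C}"
    have up: "infsum (heat_kernel C t x) A - infsum (stat C) A \<le> 1 - similarity TV C t x"
      if "x \<in> states C" "A \<subseteq> states C" for x A
      unfolding similarity_def using that markov_atD by (intro total_variation_overlap(1)) auto
    have att: "\<exists>A\<subseteq>states C. infsum (heat_kernel C t x) A - infsum (stat C) A = 1 - similarity TV C t x"
      if "x \<in> states C" for x
      unfolding similarity_def using that markov_atD by (intro total_variation_overlap(2)) auto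
    have bdd: "bdd_above ?S"
    proof (rule bdd_aboveI[of _ 1])
      show "r \<le> 1" if "r \<in> ?S" for r
      proof -
        obtain x A where "x \<in> states C" "A \<subseteq> states C" "r = infsum (heat_kernel C t x) A - infsum (stat C) A"
          using \<open>r \<in> ?S\<close> by blast
        then show ?thesis using up[of x A] similarity_bounds(1)[of x TV] by linarith
      qed
    qed
    have mem: "1 - similarity TV C t x \<in> ?S" if "x \<in> states C" for x
    proof -
      note x = that
      obtain A where A: "A \<subseteq> states C" "1 - similarity TV C t x = infsum (heat_kernel C t x) A - infsum (stat C) A"
        using att[OF x] by metis
      show ?thesis unfolding A(2) using A(1) x by blast
    qed
    have low: "1 - similarity TV C t x \<le> Sup ?S" if "x \<in> states C" for x
      by (rule cSup_upper[OF mem[OF that] bdd])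
    have least: "Sup ?S \<le> c" if "\<And>x. x \<in> states C \<Longrightarrow> 1 - similarity TV C t x \<le> c" for c
    proof (rule cSup_least)
      show "?S \<noteq> {}" using mem[OF x0] by blast
      show "r \<le> c" if "r \<in> ?S" for r
        using that up \<open>\<And>x. x \<in> states C \<Longrightarrow> 1 - similarity TV C t x \<le> c\<close> order_trans by blast
    qed
    have "0 \<le> Sup ?S"
      using low[OF x0] similarity_bounds(2)[OF x0, of TV] by linarith
    then show ?thesis using TV low least by simp
  next
    case Hellinger
    let ?d = "\<lambda>x. sqrt (1 / 2 * (\<Sum>\<^sub>\<infinity>y\<in>states C. (sqrt (heat_kernel C t x y) - sqrt (stat C y))\<^sup>2))"
    have d: "?d x = sqrt (1 - similarity Hellinger C t x)" if "x \<in> states C" for x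
    proof -
      have "(\<Sum>\<^sub>\<infinity>y\<in>states C. (sqrt (heat_kernel C t x y) - sqrt (stat C y))\<^sup>2) =
          (\<Sum>\<^sub>\<infinity>y\<in>states C. discrepancy Hellinger (heat_kernel C t x y) (stat C y))"
        using markov_atD that by (intro infsum_cong) (simp add: discrepancy_Hellinger)
      then show ?thesis
        using infsumI[OF discrepancy_similarity[OF that, of Hellinger]] by simp
    qed
    have bdd: "bdd_above (?d ` states C)"
    proof (rule bdd_aboveI2[of _ _ 1])
      show "?d x \<le> 1" if "x \<in> states C" for x
        unfolding d[OF that] real_sqrt_le_1_iff using similarity_bounds(1)[OF that, of Hellinger] by simp
    qed
    have low: "sqrt (1 - similarity Hellinger C t x) \<le> (SUP x\<in>states C. ?d x)" if "x \<in> states C" for x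
      unfolding d[OF that, symmetric] by (rule cSUP_upper[OF that bdd])
    have nn: "0 \<le> (SUP x\<in>states C. ?d x)"
      using low[OF x0] similarity_bounds(2)[OF x0, of Hellinger] real_sqrt_ge_zero
      by (meson diff_ge_0_iff_ge order_trans)
    have "1 - similarity Hellinger C t x \<le> (SUP x\<in>states C. ?d x)\<^sup>2" if "x \<in> states C" for x
      using low[OF that] nn sqrt_le_D by blast
    moreover have "(SUP x\<in>states C. ?d x)\<^sup>2 \<le> c"
      if c: "\<forall>x\<in>states C. 1 - similarity Hellinger C t x \<le> c" for c
    proof -
      have "0 \<le> c" using c x0 similarity_bounds(2)[OF x0, of Hellinger] by force
      have "(SUP x\<in>states C. ?d x) \<le> sqrt c"
      proof (rule cSUP_least)
        show "?d x \<le> sqrt c" if "x \<in> states C" for x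
          unfolding d[OF that] using c that by simp
      qed (use x0 in auto)
      then have "(SUP x\<in>states C. ?d x)\<^sup>2 \<le> (sqrt c)\<^sup>2"
        using nn by (intro power_mono)
      with \<open>0 \<le> c\<close> show ?thesis by simp
    qed
    ultimately show ?thesis
      using Hellinger nn by simp
  qed
  then show "0 \<le> chain_dist D C t"
    and "x \<in> states C \<Longrightarrow> 1 - similarity D C t x \<le> chain_dist D C t powr rho D"
    and "(\<And>x. x \<in> states C \<Longrightarrow> 1 - similarity D C t x \<le> c) \<Longrightarrow> chain_dist D C t powr rho D \<le> c"
    by auto
qed

lemmas chain_dist_nonneg = chain_dist_overlap(1)
lemmas one_minus_similarity_le = chain_dist_overlap(2)
lemmas chain_dist_leI = chain_dist_overlap(3)

lemma chain_dist_powr_le_1: "chain_dist D C t powr rho D \<le> 1"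
  using similarity_bounds(1)[of _ D] by (intro chain_dist_leI) auto

lemma chain_dist_le_1: "chain_dist D C t \<le> 1"
  using chain_dist_powr_le_1[of D] gr_one_powr[of "chain_dist D C t" "rho D"] rho_pos[of D]
  by linarith

end

context
  fixes C :: "'a mchain"
  assumes C: "irreducible_mchain C"
begin

interpretation stochastic "states C" "kernel C"
  using C by unfold_locales (simp add: irreducible_mchain_def)

lemma stationary: "stationary_distribution_on (states C) (kernel C) (stat C)"
  using C by (simp add: irreducible_mchain_def)

lemma heat_kernel_H: "heat_kernel C = H"
  by (simp add: fun_eq_iff heat_kernel_def H_def)

lemma states_nonempty: "states C \<noteq> {}"
  using stationary has_sum_unique[of "stat C" "{}" 1 0] by (auto simp: stationary_distribution_on_def)

lemma markov_at_irreducible: "0 \<le> t \<Longrightarrow> markov_at C t"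
  using stationary states_nonempty H_nonneg H_row
  by (auto simp: markov_at_def heat_kernel_H stationary_distribution_on_def)

text \<open>The law at time \<open>s + t\<close> is a mixture of the laws at time \<open>t\<close> from random starting points,
  and mixing increases the overlap.\<close>

lemma similarity_lower_bound_persists:
  assumes s: "0 \<le> s" and t: "0 \<le> t" and x: "x \<in> states C"
    and low: "\<And>z. z \<in> states C \<Longrightarrow> m \<le> similarity D C t z"
  shows "m \<le> similarity D C (s + t) x"
proof -
  note mt = markov_at_irreducible[OF t] and ms = markov_at_irreducible[OF s]
  have st: "0 \<le> s + t" using s t by simp
  note mst = markov_at_irreducible[OF st]
  define f where "f z y = heat_kernel C s x z * overlap D (heat_kernel C t z y) (stat C y)" for z y
  have nn: "0 \<le> f z y" if "z \<in> states C" "y \<in> states C" for z y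
    using markov_atD[OF mt] markov_atD[OF ms] that x by (auto simp: f_def intro!: mult_nonneg_nonneg overlap_nonneg)
  have rows: "(f z has_sum heat_kernel C s x z * similarity D C t z) (states C)" if "z \<in> states C" for z
    unfolding f_def similarity_def by (intro has_sum_cmult_right has_sum_infsum similarity_summable mt that)
  have "(\<lambda>z. heat_kernel C s x z * similarity D C t z) summable_on states C"
    by (rule summable_on_comparison_test[OF has_sum_imp_summable[OF markov_atD(3)[OF ms x]]])
      (use markov_atD[OF ms] similarity_bounds[OF mt, of _ D] x in \<open>auto intro: mult_left_le\<close>)
  then obtain S where S: "((\<lambda>z. heat_kernel C s x z * similarity D C t z) has_sum S) (states C)"
    by (auto simp: summable_on_def)
  have "m = 1 * m" by simp
  also have "1 * m \<le> S"
    by (rule has_sum_mono[OF has_sum_cmult_left[OF markov_atD(3)[OF ms x], of m] S])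
      (use markov_atD[OF ms] low x in \<open>auto intro!: mult_left_mono\<close>)
  also have "S \<le> similarity D C (s + t) x"
    unfolding similarity_def
  proof (rule has_sum_mono[OF has_sum_swap_nonneg_infsum(2)[OF nn rows S] has_sum_infsum[OF similarity_summable[OF mst x]]])
    fix y assume y: "y \<in> states C"
    have "(\<Sum>\<^sub>\<infinity>z\<in>states C. f z y) =
        (\<Sum>\<^sub>\<infinity>z\<in>states C. overlap D (heat_kernel C s x z * heat_kernel C t z y) (heat_kernel C s x z * stat C y))"
      unfolding f_def using markov_atD[OF mt] markov_atD[OF ms] x y
      by (intro infsum_cong) (simp add: overlap_scale)
    also have "\<dots> \<le> overlap D (heat_kernel C (s + t) x y) (1 * stat C y)"
      using H_semigroup[OF s t x y] has_sum_cmult_left[OF markov_atD(3)[OF ms x], of "stat C y"]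
        markov_atD[OF mt] markov_atD[OF ms] x y
      by (intro infsum_overlap_le) (auto simp: heat_kernel_H)
    finally show "(\<Sum>\<^sub>\<infinity>z\<in>states C. f z y) \<le> overlap D (heat_kernel C (s + t) x y) (stat C y)"
      by simp
  qed
  finally show ?thesis .
qed

lemma chain_dist_antimono:
  assumes "0 \<le> t" "t \<le> u"
  shows "chain_dist D C u \<le> chain_dist D C t"
proof -
  have u: "u = (u - t) + t" "0 \<le> u - t" "0 \<le> u" using assms by auto
  have "chain_dist D C u powr rho D \<le> chain_dist D C t powr rho D"
  proof (rule chain_dist_leI[OF markov_at_irreducible[OF u(3)]])
    fix x assume x: "x \<in> states C"
    have "1 - chain_dist D C t powr rho D \<le> similarity D C ((u - t) + t) x"
      by (rule similarity_lower_bound_persists[OF u(2) assms(1) x]) (use one_minus_similarity_le[OF markov_at_irreducible[OF assms(1)], of _ D] in force)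
    then show "1 - similarity D C u x \<le> chain_dist D C t powr rho D" using u by simp
  qed
  then show ?thesis
    using chain_dist_nonneg[OF markov_at_irreducible] assms u rho_pos[of D] powr_less_mono2
    by (metis linorder_not_less)
qed

text \<open>Conditioning on the state \<open>z\<close> at time \<open>s\<close>, each discrepancy at time \<open>s + t\<close> is at most a
  constant times a sum over \<open>z\<close> of products of discrepancies; summing over the final state first
  bounds the second factor uniformly in \<open>z\<close>.\<close>

lemma chain_dist_submult:
  assumes s: "0 \<le> s" and t: "0 \<le> t"
  shows "chain_dist D C (s + t) \<le> 2 * rho D * chain_dist D C s * chain_dist D C t"
proof -
  note mt = markov_at_irreducible[OF t] and ms = markov_at_irreducible[OF s]
  have st: "0 \<le> s + t" using s t by simp
  note mst = markov_at_irreducible[OF st]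
  let ?H = "heat_kernel C" and ?\<pi> = "stat C" and ?X = "states C"
  define a b k where "a = chain_dist D C s powr rho D" and "b = chain_dist D C t powr rho D"
    and "k = (2 * rho D) powr rho D"
  have "chain_dist D C (s + t) powr rho D \<le> k * a * b"
  proof (rule chain_dist_leI[OF mst])
    fix x assume x: "x \<in> ?X"
    define f where "f z y = discrepancy D (?H s x z) (?\<pi> z) * discrepancy D (?H t z y) (?\<pi> y)" for z y
    have dnn: "0 \<le> discrepancy D (?H s x z) (?\<pi> z)" "0 \<le> discrepancy D (?H t z y) (?\<pi> y)" if "z \<in> ?X" "y \<in> ?X" for z y
      using markov_atD[OF mt] markov_atD[OF ms] that x by (auto intro!: discrepancy_nonneg)
    have nn: "0 \<le> f z y" if "z \<in> ?X" "y \<in> ?X" for z y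
      using dnn that by (auto simp: f_def)
    have rows: "(f z has_sum discrepancy D (?H s x z) (?\<pi> z) * (2 * (1 - similarity D C t z))) ?X" if "z \<in> ?X" for z
      unfolding f_def by (intro has_sum_cmult_right discrepancy_similarity mt that)
    have le: "discrepancy D (?H s x z) (?\<pi> z) * (2 * (1 - similarity D C t z)) \<le> discrepancy D (?H s x z) (?\<pi> z) * (2 * b)" if "z \<in> ?X" for z
      using one_minus_similarity_le[OF mt that, of D] dnn(1)[OF that that] by (intro mult_left_mono) (auto simp: b_def)
    have tot: "((\<lambda>z. discrepancy D (?H s x z) (?\<pi> z) * (2 * b)) has_sum 2 * (1 - similarity D C s x) * (2 * b)) ?X"
      by (intro has_sum_cmult_left discrepancy_similarity ms x)
    have "(\<lambda>z. discrepancy D (?H s x z) (?\<pi> z) * (2 * (1 - similarity D C t z))) summable_on ?X"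
      by (rule summable_on_comparison_test[OF has_sum_imp_summable[OF tot] le])
        (use dnn(1) similarity_bounds(2)[OF mt, of _ D] in auto)
    then obtain S where S: "((\<lambda>z. discrepancy D (?H s x z) (?\<pi> z) * (2 * (1 - similarity D C t z))) has_sum S) ?X"
      by (auto simp: summable_on_def)
    have swap: "(\<lambda>z. f z y) summable_on ?X" if "y \<in> ?X" for y
      by (rule has_sum_swap_nonneg_infsum(1)[OF nn rows S]) (simp_all add: that)
    have "S \<le> 2 * (1 - similarity D C s x) * (2 * b)"
      by (rule has_sum_mono[OF S tot le])
    also have "\<dots> \<le> 2 * a * (2 * b)"
      using one_minus_similarity_le[OF ms x, of D] similarity_bounds(2)[OF ms x, of D]
      by (intro mult_mono) (auto simp: a_def b_def)
    finally have Sab: "S \<le> 4 * a * b" by simp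
    have "2 * (2 * (1 - similarity D C (s + t) x)) \<le> k * S"
    proof (rule has_sum_mono[OF has_sum_cmult_right[OF discrepancy_similarity[OF mst x]] has_sum_cmult_right[OF
          has_sum_swap_nonneg_infsum(2)[OF nn rows S]]])
      fix y assume y: "y \<in> ?X"
      show "2 * discrepancy D (?H (s + t) x y) (?\<pi> y) \<le> k * (\<Sum>\<^sub>\<infinity>z\<in>?X. f z y)"
        unfolding f_def k_def
      proof (rule discrepancy_mixture)
        show "((\<lambda>z. ?H s x z * ?H t z y) has_sum ?H (s + t) x y) ?X"
          using H_semigroup[OF s t x y] by (simp add: heat_kernel_H)
        show "((\<lambda>z. ?\<pi> z * ?H t z y) has_sum ?\<pi> y) ?X"
          using H_stationary[OF stationary t y] by (simp add: heat_kernel_H)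
        show "(\<lambda>z. discrepancy D (?H s x z) (?\<pi> z) * discrepancy D (?H t z y) (?\<pi> y)) summable_on ?X"
          using swap[OF y] by (simp add: f_def)
      qed (use markov_atD[OF mt] markov_atD[OF ms] x y in auto)
    qed auto
    also have "\<dots> \<le> k * (4 * a * b)"
      using Sab by (intro mult_left_mono) (auto simp: k_def)
    finally show "1 - similarity D C (s + t) x \<le> k * a * b" by simp
  qed
  also have "\<dots> = (2 * rho D * chain_dist D C s * chain_dist D C t) powr rho D"
    using chain_dist_nonneg[OF ms, of D] chain_dist_nonneg[OF mt, of D] rho_pos[of D]
    by (simp add: k_def a_def b_def powr_mult)
  finally show ?thesis
    using rho_pos[of D] chain_dist_nonneg[OF mst, of D]
      chain_dist_nonneg[OF ms, of D] chain_dist_nonneg[OF mt, of D]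
    by (subst (asm) powr_le_cancel_iff_nonneg) auto
qed

end

section \<open>Product chains\<close>

lemma weight_sum_pos:
  assumes "\<And>i. i \<in> {1..n} \<Longrightarrow> 0 < p i" "1 \<le> n"
  shows "0 < weight_sum p n"
  unfolding weight_sum_def using assms by (intro sum_pos) auto

context
  fixes F :: "nat \<Rightarrow> 'a mchain" and p :: "nat \<Rightarrow> real" and n :: nat
  assumes chains: "\<And>i. i \<in> {1..n} \<Longrightarrow> irreducible_mchain (F i)"
    and p_pos: "\<And>i. i \<in> {1..n} \<Longrightarrow> 0 < p i"
    and n: "1 \<le> n"
begin

private abbreviation (input) "q \<equiv> weight_sum p n"
private abbreviation (input) "G \<equiv> product_family F p n"

private lemma q_gt_0: "0 < q"
  by (rule weight_sum_pos[OF p_pos n])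

text \<open>As the weights \<open>p i / weight_sum p n\<close> add up to one, the identity can be distributed over
  the coordinates, which makes the generator of the product a Kronecker sum of generators that run
  at these speeds.\<close>

lemma heat_kernel_product:
  assumes x: "x \<in> states G" and y: "y \<in> states G"
  shows "heat_kernel G t x y = (\<Prod>i=1..n. heat_kernel (F i) (t * p i / q) (x i) (y i))"
proof -
  let ?X = "\<lambda>i. states (F i)"
  define A where "A i = (\<lambda>a b. - (t * p i / q) * (of_bool (a = b) - kernel (F i) a b))" for i
  have X: "states G = PiE {1..n} ?X" by (simp add: product_family_def)
  have "heat_kernel G t x y = mat_exp (states G) (kronecker_sum {1..n} A) x y"
    unfolding heat_kernel_def
  proof (rule mat_exp_cong[OF _ x])
    fix x z assume x: "x \<in> states G" and z: "z \<in> states G"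
    have eq: "of_bool (x = z) = (\<Prod>j=1..n. of_bool (x j = z j) :: real)"
      using PiE_ext[of x "{1..n}" ?X z] x z by (cases "x = z") (auto simp: X)
    have one: "(\<Prod>j=1..n. of_bool (x j = z j) :: real) = of_bool (x i = z i) * (\<Prod>j\<in>{1..n} - {i}. of_bool (x j = z j))"
      if "i \<in> {1..n}" for i
      using that by (simp add: prod.remove)
    have two: "(\<Prod>j=1..n. if j = i then kernel (F j) (x j) (z j) else of_bool (x j = z j)) =
        kernel (F i) (x i) (z i) * (\<Prod>j\<in>{1..n} - {i}. of_bool (x j = z j))" if "i \<in> {1..n}" for i
      using that by (subst prod.remove[of _ i]) (auto intro!: prod.cong)
    have "(\<Sum>i=1..n. p i / q) = 1"
      using q_gt_0 by (simp add: weight_sum_def flip: sum_divide_distrib)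
    then have "of_bool (x = z) = (\<Sum>i=1..n. p i / q * (\<Prod>j=1..n. of_bool (x j = z j)) :: real)"
      unfolding eq sum_distrib_right[symmetric] by simp
    then have "- t * (of_bool (x = z) - kernel G x z) =
        (\<Sum>i=1..n. - t * (p i / q * (\<Prod>j=1..n. of_bool (x j = z j)) -
          p i / q * (\<Prod>j=1..n. if j = i then kernel (F j) (x j) (z j) else of_bool (x j = z j))))"
      unfolding sum_distrib_left[symmetric] by (simp add: product_family_def sum_subtractf)
    also have "\<dots> = kronecker_sum {1..n} A x z"
      unfolding kronecker_sum_def
    proof (rule sum.cong[OF refl])
      fix i assume i: "i \<in> {1..n}"
      show "- t * (p i / q * (\<Prod>j=1..n. of_bool (x j = z j)) -
          p i / q * (\<Prod>j=1..n. if j = i then kernel (F j) (x j) (z j) else of_bool (x j = z j))) =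
        A i (x i) (z i) * (\<Prod>j\<in>{1..n} - {i}. of_bool (x j = z j))"
        unfolding one[OF i] two[OF i] A_def by (simp add: algebra_simps)
    qed
    finally show "- t * (of_bool (x = z) - kernel G x z) = kronecker_sum {1..n} A x z" .
  qed
  also have "\<dots> = (\<Prod>i=1..n. mat_exp (?X i) (A i) (x i) (y i))"
    unfolding X
  proof (rule mat_exp_kronecker_sum)
    show "rows_bounded (?X i) (A i) (2 * \<bar>- (t * p i / q)\<bar>)" if "i \<in> {1..n}" for i
      unfolding A_def using chains[OF that] by (intro rows_bounded_generator) (simp add: irreducible_mchain_def)
  qed (use x y X in auto)
  also have "\<dots> = (\<Prod>i=1..n. heat_kernel (F i) (t * p i / q) (x i) (y i))"
    by (simp add: A_def heat_kernel_def)
  finally show ?thesis .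
qed

lemma component_time_nonneg: "0 \<le> t \<Longrightarrow> i \<in> {1..n} \<Longrightarrow> 0 \<le> t * p i / q"
  using p_pos q_gt_0 by (auto simp: less_imp_le)

lemma markov_at_component: "0 \<le> t \<Longrightarrow> i \<in> {1..n} \<Longrightarrow> markov_at (F i) (t * p i / q)"
  by (intro markov_at_irreducible chains component_time_nonneg)

lemma markov_at_product:
  assumes t: "0 \<le> t"
  shows "markov_at G t"
proof -
  note m = markov_atD[OF markov_at_component[OF t]]
  have X: "states G = PiE {1..n} (\<lambda>i. states (F i))" by (simp add: product_family_def)
  show ?thesis
    unfolding markov_at_def
  proof (intro conjI ballI)
    show "states G \<noteq> {}"
      unfolding X using m(1) by (auto simp: PiE_eq_empty_iff)
    fix x assume x: "x \<in> states G"
    have xi: "x i \<in> states (F i)" if "i \<in> {1..n}" for i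
      using x that unfolding X by (rule PiE_mem)
    show "0 \<le> heat_kernel G t x y" if y: "y \<in> states G" for y
      unfolding heat_kernel_product[OF x y]
    proof (rule prod_nonneg)
      fix i assume i: "i \<in> {1..n}"
      show "0 \<le> heat_kernel (F i) (t * p i / q) (x i) (y i)"
        using m(2)[OF i xi[OF i] PiE_mem[OF y[unfolded X] i]] .
    qed
    have "((\<lambda>y. \<Prod>i=1..n. heat_kernel (F i) (t * p i / q) (x i) (y i)) has_sum (\<Prod>i=1..n. 1)) (states G)"
      unfolding X using m(2)[OF _ xi] m(3)[OF _ xi] by (intro has_sum_prod_PiE_nonneg) auto
    then show "(heat_kernel G t x has_sum 1) (states G)"
      by (subst has_sum_cong[OF heat_kernel_product[OF x]]) auto
  next
    show "0 \<le> stat G y" if y: "y \<in> states G" for y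
      unfolding product_family_def mchain.simps
    proof (rule prod_nonneg)
      fix i assume i: "i \<in> {1..n}"
      show "0 \<le> stat (F i) (y i)"
        using m(4)[OF i PiE_mem[OF y[unfolded X] i]] .
    qed
    have "((\<lambda>y. \<Prod>i=1..n. stat (F i) (y i)) has_sum (\<Prod>i=1..n. 1)) (states G)"
      unfolding X using m(4,5) by (intro has_sum_prod_PiE_nonneg) auto
    then show "(stat G has_sum 1) (states G)"
      by (simp add: product_family_def)
  qed
qed

lemma similarity_product_bounds:
  assumes t: "0 \<le> t" and x: "x \<in> states G"
  shows "(\<Prod>i=1..n. similarity D (F i) (t * p i / q) (x i)) \<le> similarity D G t x"
    and "i \<in> {1..n} \<Longrightarrow> similarity D G t x \<le> similarity D (F i) (t * p i / q) (x i)"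
proof -
  note m = markov_atD[OF markov_at_component[OF t]]
  have X: "states G = PiE {1..n} (\<lambda>i. states (F i))" by (simp add: product_family_def)
  have xi: "x i \<in> states (F i)" if "i \<in> {1..n}" for i
    using x that unfolding X by (rule PiE_mem)
  have eq: "similarity D G t x = (\<Sum>\<^sub>\<infinity>y\<in>PiE {1..n} (\<lambda>i. states (F i)).
      overlap D (\<Prod>i=1..n. heat_kernel (F i) (t * p i / q) (x i) (y i)) (\<Prod>i=1..n. stat (F i) (y i)))"
    unfolding similarity_def X[symmetric] using heat_kernel_product[OF x]
    by (intro infsum_cong) (simp add: product_family_def)
  note b = overlap_product_bounds[where I = "{1..n}" and X = "\<lambda>i. states (F i)"
      and \<mu> = "\<lambda>i. heat_kernel (F i) (t * p i / q) (x i)" and \<nu> = "\<lambda>i. stat (F i)" and D = D,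
      OF finite_atLeastAtMost m(2)[OF _ xi] m(3)[OF _ xi] m(4) m(5)]
  show "(\<Prod>i=1..n. similarity D (F i) (t * p i / q) (x i)) \<le> similarity D G t x"
    unfolding eq unfolding similarity_def by (rule b(1))
  show "similarity D G t x \<le> similarity D (F i) (t * p i / q) (x i)" if "i \<in> {1..n}"
    unfolding eq unfolding similarity_def by (rule b(2)[OF _ _ _ _ _ _ _ _ that])
qed

lemma chain_dist_product_ge:
  assumes t: "0 \<le> t" and i: "i \<in> {1..n}"
  shows "chain_dist D (F i) (t * p i / q) \<le> chain_dist D G t"
proof -
  note mi = markov_at_component[OF t i] and mG = markov_at_product[OF t]
  have X: "states G = PiE {1..n} (\<lambda>i. states (F i))" by (simp add: product_family_def)
  have "chain_dist D (F i) (t * p i / q) powr rho D \<le> chain_dist D G t powr rho D"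
  proof (rule chain_dist_leI[OF mi])
    fix a assume a: "a \<in> states (F i)"
    obtain x where x: "x \<in> states G" using markov_atD(1)[OF mG] by blast
    have x': "x(i := a) \<in> states G"
      using x a i unfolding X by (auto simp: PiE_iff extensional_def)
    show "1 - similarity D (F i) (t * p i / q) a \<le> chain_dist D G t powr rho D"
      using similarity_product_bounds(2)[OF t x' i, of D] one_minus_similarity_le[OF mG x', of D] by simp
  qed
  then show ?thesis
    using chain_dist_nonneg[OF mG, of D] chain_dist_nonneg[OF mi, of D] rho_pos[of D]
      powr_less_mono2[of "rho D" "chain_dist D G t" "chain_dist D (F i) (t * p i / q)"] by force
qed

text \<open>For total variation this is the coupling bound for independent coordinates; for the
  Hellinger distance the affinity is multiplicative.\<close>

lemma chain_dist_product_le: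
  assumes t: "0 \<le> t"
  shows "(\<Prod>i=1..n. 1 - chain_dist D (F i) (t * p i / q) powr rho D) \<le> 1 - chain_dist D G t powr rho D"
proof -
  note m = markov_at_component[OF t] and mG = markov_at_product[OF t]
  have X: "states G = PiE {1..n} (\<lambda>i. states (F i))" by (simp add: product_family_def)
  have "chain_dist D G t powr rho D \<le> 1 - (\<Prod>i=1..n. 1 - chain_dist D (F i) (t * p i / q) powr rho D)"
  proof (rule chain_dist_leI[OF mG])
    fix x assume x: "x \<in> states G"
    have "(\<Prod>i=1..n. 1 - chain_dist D (F i) (t * p i / q) powr rho D) \<le>
        (\<Prod>i=1..n. similarity D (F i) (t * p i / q) (x i))"
    proof (rule prod_mono)
      fix i assume i: "i \<in> {1..n}"
      have "x i \<in> states (F i)" using x i unfolding X by (rule PiE_mem)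
      then show "0 \<le> 1 - chain_dist D (F i) (t * p i / q) powr rho D \<and>
          1 - chain_dist D (F i) (t * p i / q) powr rho D \<le> similarity D (F i) (t * p i / q) (x i)"
        using one_minus_similarity_le[OF m[OF i], of "x i" D] chain_dist_powr_le_1[OF m[OF i], of D] by auto
    qed
    then show "1 - similarity D G t x \<le> 1 - (\<Prod>i=1..n. 1 - chain_dist D (F i) (t * p i / q) powr rho D)"
      using similarity_product_bounds(1)[OF t x, of D] by simp
  qed
  then show ?thesis by simp
qed

end

section \<open>Cutoff for families and their products\<close>

lemma one_minus_sum_le_prod:
  fixes x :: "'i \<Rightarrow> real"
  assumes "finite I" "\<And>i. i \<in> I \<Longrightarrow> 0 \<le> x i" "\<And>i. i \<in> I \<Longrightarrow> x i \<le> 1"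
  shows "1 - (\<Sum>i\<in>I. x i) \<le> (\<Prod>i\<in>I. 1 - x i)"
  using assms
proof (induction I)
  case (insert i I)
  have "x i * (\<Prod>j\<in>I. 1 - x j) \<le> x i * 1"
    using insert by (intro mult_left_mono prod_le_1) auto
  then show ?case using insert by (simp add: algebra_simps)
qed auto

lemma increasing_pos_seq_less: "increasing_pos_seq \<xi> \<Longrightarrow> 1 \<le> i \<Longrightarrow> i < n \<Longrightarrow> \<xi> i < \<xi> n"
  by (auto simp: increasing_pos_seq_def strict_mono_on_def)

lemma increasing_pos_seq_pos: "increasing_pos_seq \<xi> \<Longrightarrow> 1 \<le> i \<Longrightarrow> 1 \<le> \<xi> i"
  by (auto simp: increasing_pos_seq_def)

lemma increasing_pos_seq_gap:
  assumes "increasing_pos_seq \<xi>" "1 \<le> i" "i \<le> n"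
  shows "\<xi> i + (n - i) \<le> \<xi> n"
  using assms(3)
proof (induction n rule: dec_induct)
  case (step n)
  then show ?case using increasing_pos_seq_less[OF assms(1), of n "Suc n"] assms(2) by simp
qed simp

lemma increasing_pos_seq_ge: "increasing_pos_seq \<xi> \<Longrightarrow> 1 \<le> n \<Longrightarrow> n \<le> \<xi> n"
  using increasing_pos_seq_gap[of \<xi> 1 n] increasing_pos_seq_pos[of \<xi> 1] by simp

lemma increasing_pos_seq_comp:
  "increasing_pos_seq \<xi> \<Longrightarrow> increasing_pos_seq \<zeta> \<Longrightarrow> increasing_pos_seq (\<xi> \<circ> \<zeta>)"
  by (auto simp: increasing_pos_seq_def strict_mono_on_def)

lemma increasing_pos_seq_strict_mono:
  assumes "strict_mono \<xi>" "1 \<le> \<xi> 0"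
  shows "increasing_pos_seq \<xi>"
proof -
  have "\<xi> 0 \<le> \<xi> n" for n
    using assms(1) by (simp add: strict_mono_less_eq)
  then have "1 \<le> \<xi> n" for n
    using assms(2) order_trans by blast
  then show ?thesis
    using assms(1) by (auto simp: increasing_pos_seq_def strict_mono_on_def strict_mono_def)
qed

text \<open>The hypotheses of the theorem in a form that is inherited by subfamilies: the supremum and
  the infimum of \<open>\<epsilon>\<close> are replaced by bounds \<open>\<theta>\<close> and \<open>\<delta>\<close> that do not depend on the subfamily, and
  the iterated limit by the existence of a suitable \<open>m\<close> for each \<open>\<eta>\<close>.\<close>

locale cutoff_setting =
  fixes D :: dist_kind and F :: "nat \<Rightarrow> 'a mchain" and p \<epsilon> :: "nat \<Rightarrow> real"
    and c0 :: real and N :: nat and \<theta> \<delta> :: real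
  assumes chains: "\<And>n. n \<ge> 1 \<Longrightarrow> irreducible_mchain (F n)"
    and p_pos: "\<And>n. n \<ge> 1 \<Longrightarrow> 0 < p n"
    and c0: "0 < c0" "c0 < 1"
    and \<delta>: "0 < \<delta>" "\<And>n. n \<ge> 1 \<Longrightarrow> \<delta> \<le> \<epsilon> n"
    and \<theta>: "\<theta> < 1" "\<And>n. n \<ge> 1 \<Longrightarrow> 2 * rho D * \<epsilon> n \<le> \<theta>"
    and T_finite: "\<And>n. n \<ge> 1 \<Longrightarrow> mixing_finite D (F n) (\<epsilon> n)"
    and T_pos: "\<And>n. n \<ge> 1 \<Longrightarrow> 0 < mixing_time D (F n) (\<epsilon> n)"
    and max_cond: "\<And>n i. n \<ge> N \<Longrightarrow> 1 \<le> i \<Longrightarrow> i \<le> n \<Longrightarrow>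
      mixing_time D (F i) (\<epsilon> i) / p i \<le> mixing_time D (F n) (\<epsilon> n) / p n"
    and lim_cond: "\<And>\<eta>. 0 < \<eta> \<Longrightarrow> \<exists>m. \<forall>\<^sub>F n in sequentially. (\<Sum>i=1..n - m.
      \<theta> powr (c0 * rho D * mixing_time D (F n) (\<epsilon> n) * p i / (mixing_time D (F i) (\<epsilon> i) * p n))) < \<eta>"
begin

definition T :: "nat \<Rightarrow> real" where
  "T n = mixing_time D (F n) (\<epsilon> n)"

abbreviation d :: "nat \<Rightarrow> real \<Rightarrow> real" where
  "d n \<equiv> chain_dist D (F n)"

abbreviation dP :: "nat \<Rightarrow> real \<Rightarrow> real" where
  "dP n \<equiv> chain_dist D (product_family F p n)"

lemma rho_ge_1: "1 \<le> rho D"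
  by (cases D) auto

lemma \<theta>_pos: "0 < \<theta>"
proof -
  have "0 < 2 * rho D * \<epsilon> 1" using \<delta>(1) \<delta>(2)[of 1] rho_ge_1 by auto
  then show ?thesis using \<theta>(2)[of 1] by linarith
qed

lemma T_gt_0: "1 \<le> n \<Longrightarrow> 0 < T n"
  using T_pos by (simp add: T_def)

lemma T_nonneg: "1 \<le> n \<Longrightarrow> 0 \<le> T n"
  using T_gt_0 less_imp_le by blast

lemma d_nonneg: "1 \<le> n \<Longrightarrow> 0 \<le> t \<Longrightarrow> 0 \<le> d n t"
  by (intro chain_dist_nonneg markov_at_irreducible chains)

lemma d_le_1: "1 \<le> n \<Longrightarrow> 0 \<le> t \<Longrightarrow> d n t \<le> 1"
  by (intro chain_dist_le_1 markov_at_irreducible chains)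

lemma d_antimono: "1 \<le> n \<Longrightarrow> 0 \<le> s \<Longrightarrow> s \<le> t \<Longrightarrow> d n t \<le> d n s"
  by (intro chain_dist_antimono chains)

lemma d_powr_bounds:
  assumes "1 \<le> n" "0 \<le> t"
  shows "0 \<le> d n t powr rho D" "d n t powr rho D \<le> 1"
  using chain_dist_powr_le_1[OF markov_at_irreducible[OF chains]] assms by auto

lemma T_le: "1 \<le> n \<Longrightarrow> 0 \<le> s \<Longrightarrow> d n s \<le> \<epsilon> n \<Longrightarrow> T n \<le> s"
  unfolding T_def mixing_time_def by (intro cInf_lower bdd_belowI[of _ 0]) auto

lemma d_le_eps:
  assumes "1 \<le> n" "T n < s"
  shows "d n s \<le> \<epsilon> n"
proof -
  have "{t. 0 \<le> t \<and> d n t \<le> \<epsilon> n} \<noteq> {}"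
    using T_finite[OF assms(1)] by (auto simp: mixing_finite_def)
  then obtain t where "0 \<le> t" "d n t \<le> \<epsilon> n" "t < s"
    using assms(2) cInf_lessD[of "{t. 0 \<le> t \<and> d n t \<le> \<epsilon> n}" s] by (auto simp: T_def mixing_time_def)
  then show ?thesis using d_antimono[OF assms(1), of t s] by simp
qed

lemma d_multiple:
  assumes n: "1 \<le> n" and s: "T n < s"
  shows "d n (real k * s) \<le> \<theta> ^ k"
proof (cases k)
  case 0
  then show ?thesis using d_le_1[OF n, of 0] by simp
next
  case (Suc l)
  have s0: "0 \<le> s" using s T_gt_0[OF n] by simp
  have base: "2 * rho D * d n s \<le> \<theta>"
    using mult_left_mono[OF d_le_eps[OF n s], of "2 * rho D"] \<theta>(2)[OF n] rho_ge_1 by linarith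
  have *: "2 * rho D * d n (real (Suc l) * s) \<le> \<theta> ^ Suc l"
  proof (induction l)
    case 0
    then show ?case using base by simp
  next
    case (Suc l)
    have "real (Suc (Suc l)) * s = real (Suc l) * s + s" by (simp add: algebra_simps)
    then have "d n (real (Suc (Suc l)) * s) \<le> 2 * rho D * d n (real (Suc l) * s) * d n s"
      using chain_dist_submult[OF chains[OF n], of "real (Suc l) * s" s D] s0 by simp
    then have "2 * rho D * d n (real (Suc (Suc l)) * s) \<le>
        2 * rho D * (2 * rho D * d n (real (Suc l) * s) * d n s)"
      using rho_ge_1 by (intro mult_left_mono) auto
    also have "\<dots> = (2 * rho D * d n (real (Suc l) * s)) * (2 * rho D * d n s)"
      by simp
    also have "\<dots> \<le> \<theta> ^ Suc l * \<theta>"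
      using Suc.IH base d_nonneg[OF n] s0 rho_ge_1 \<theta>_pos by (intro mult_mono) auto
    finally show ?case by (simp add: mult.commute)
  qed
  have "1 * d n (real (Suc l) * s) \<le> 2 * rho D * d n (real (Suc l) * s)"
    using rho_ge_1 d_nonneg[OF n] s0 by (intro mult_right_mono) auto
  with * show ?thesis using Suc by simp
qed

text \<open>The factor \<open>b > 1\<close> is needed because the distance is known to be at most \<open>\<epsilon> n\<close> only after
  the mixing time, and the \<open>- 1\<close> accounts for rounding \<open>x / b\<close> down to an integer.\<close>

lemma d_decay:
  assumes n: "1 \<le> n" and x: "0 \<le> x" and b: "1 < b"
  shows "d n (x * T n) \<le> \<theta> powr (x / b - 1)"
proof -
  define k where "k = nat \<lfloor>x / b\<rfloor>"
  have k: "real k \<le> x / b" "x / b - 1 \<le> real k"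
    using x b by (auto simp: k_def)
  have "real k * (b * T n) \<le> x * T n"
    using k(1) b T_gt_0[OF n] by (simp add: field_simps)
  then have "d n (x * T n) \<le> d n (real k * (b * T n))"
    using b T_gt_0[OF n] by (intro d_antimono n) auto
  also have "\<dots> \<le> \<theta> ^ k"
    using b T_gt_0[OF n] by (intro d_multiple n) auto
  also have "\<theta> ^ k = \<theta> powr real k"
    using \<theta>_pos by (simp add: powr_realpow)
  also have "\<dots> \<le> \<theta> powr (x / b - 1)"
    using \<theta>_pos \<theta>(1) k(2) by (intro powr_mono') auto
  finally show ?thesis .
qed

text \<open>The decay of the \<open>i\<close>th chain at \<open>a * e\<close> times its mixing time, where
  \<open>e = T n * p i / (T i * p n)\<close>. The choice \<open>b = a / c0\<close> in \<open>d_decay\<close> produces exactly the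
  exponent of the summability assumption; rounding only costs a constant factor.\<close>

lemma component_tail_bound:
  assumes n: "1 \<le> n" and i: "1 \<le> i" and a: "c0 < a" and u: "a * T n \<le> u"
  shows "d i (u * p i / p n) powr rho D \<le>
    \<theta> powr (- rho D) * \<theta> powr (c0 * rho D * T n * p i / (T i * p n))"
proof -
  define e where "e = T n * p i / (T i * p n)"
  have pos: "0 < T n" "0 < T i" "0 < p n" "0 < p i"
    using T_gt_0 p_pos n i by auto
  have e: "0 < e" using pos by (simp add: e_def)
  have a0: "0 < a" using a c0 by simp
  have "a * e * T i = a * T n * (p i / p n)" using pos by (simp add: e_def)
  also have "\<dots> \<le> u * (p i / p n)"
    using u pos by (intro mult_right_mono) auto
  finally have "d i (u * p i / p n) \<le> d i (a * e * T i)"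
    using a0 e pos by (intro d_antimono i) auto
  also have "\<dots> \<le> \<theta> powr (a * e / (a / c0) - 1)"
    using a0 e a c0 by (intro d_decay i) auto
  also have "a * e / (a / c0) - 1 = c0 * e - 1" using a0 by simp
  finally have *: "d i (u * p i / p n) \<le> \<theta> powr (c0 * e - 1)" .
  have "0 \<le> u" using u a0 pos by (meson less_imp_le mult_nonneg_nonneg order_trans)
  then have "d i (u * p i / p n) powr rho D \<le> (\<theta> powr (c0 * e - 1)) powr rho D"
    using * rho_ge_1 pos by (intro powr_mono2 d_nonneg i) auto
  also have "\<dots> = \<theta> powr (- rho D) * \<theta> powr (c0 * rho D * e)"
    by (simp add: powr_powr algebra_simps flip: powr_add)
  finally show ?thesis by (simp add: e_def mult.assoc)
qed

lemma early_components_negligible: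
  assumes a: "c0 < a" and u: "\<forall>\<^sub>F n in sequentially. a * T n \<le> u n" and \<eta>: "0 < \<eta>"
  shows "\<exists>m. \<forall>\<^sub>F n in sequentially. (\<Sum>i=1..n - m. d i (u n * p i / p n) powr rho D) < \<eta>"
proof -
  define C where "C = \<theta> powr (- rho D)"
  have C: "0 < C" using \<theta>_pos by (simp add: C_def)
  obtain m where m: "\<forall>\<^sub>F n in sequentially. (\<Sum>i=1..n - m.
      \<theta> powr (c0 * rho D * T n * p i / (T i * p n))) < \<eta> / C"
    using lim_cond[of "\<eta> / C"] \<eta> C by (auto simp: T_def)
  have "\<forall>\<^sub>F n in sequentially. (\<Sum>i=1..n - m. d i (u n * p i / p n) powr rho D) < \<eta>"
    using m u eventually_ge_at_top[of 1]
  proof eventually_elim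
    case (elim n)
    have "(\<Sum>i=1..n - m. d i (u n * p i / p n) powr rho D) \<le>
        (\<Sum>i=1..n - m. C * \<theta> powr (c0 * rho D * T n * p i / (T i * p n)))"
      unfolding C_def using elim by (intro sum_mono component_tail_bound[OF _ _ a]) auto
    also have "\<dots> = C * (\<Sum>i=1..n - m. \<theta> powr (c0 * rho D * T n * p i / (T i * p n)))"
      by (simp add: sum_distrib_left)
    also have "\<dots> < C * (\<eta> / C)"
      using elim(1) C by (intro mult_strict_left_mono)
    finally show ?case using C by simp
  qed
  then show ?thesis ..
qed

lemma T_le_eventually:
  assumes lim: "(\<lambda>n. d n (u n)) \<longlonglongrightarrow> 0" and u: "\<forall>\<^sub>F n in sequentially. 0 \<le> u n"
  shows "\<forall>\<^sub>F n in sequentially. T n \<le> u n"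
  using order_tendstoD(2)[OF lim \<delta>(1)] u eventually_ge_at_top[of 1]
proof eventually_elim
  case (elim n)
  then show ?case using T_le[of n "u n"] \<delta>(2)[of n] by auto
qed

lemma le_T_eventually:
  assumes lim: "(\<lambda>n. d n (u n)) \<longlonglongrightarrow> 1"
  shows "\<forall>\<^sub>F n in sequentially. u n \<le> T n"
  using order_tendstoD(1)[OF lim \<theta>(1)] eventually_ge_at_top[of 1]
proof eventually_elim
  case (elim n)
  show ?case
  proof (rule ccontr)
    assume "\<not> u n \<le> T n"
    then have "d n (u n) \<le> \<epsilon> n" using d_le_eps elim by auto
    also have "\<epsilon> n \<le> 2 * rho D * \<epsilon> n"
      using \<delta>(1) \<delta>(2)[of n] elim rho_ge_1 by (simp add: mult_le_cancel_right1)
    also have "\<dots> \<le> \<theta>" using \<theta>(2) elim by auto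
    finally show False using elim by simp
  qed
qed

lemma cutoff_time_compare:
  assumes t: "cutoff_time D F t"
  shows "1 < b \<Longrightarrow> \<forall>\<^sub>F n in sequentially. T n \<le> b * t n"
    and "0 < b \<Longrightarrow> b < 1 \<Longrightarrow> \<forall>\<^sub>F n in sequentially. b * t n \<le> T n"
proof -
  show "\<forall>\<^sub>F n in sequentially. T n \<le> b * t n" if "1 < b"
  proof (rule T_le_eventually)
    show "\<forall>\<^sub>F n in sequentially. 0 \<le> b * t n"
      using t that by (intro eventually_sequentiallyI[of 1] mult_nonneg_nonneg)
        (auto simp: cutoff_time_def intro: less_imp_le)
  qed (use t that in \<open>auto simp: cutoff_time_def\<close>)
  show "\<forall>\<^sub>F n in sequentially. b * t n \<le> T n" if "0 < b" "b < 1"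
    using t that by (intro le_T_eventually) (auto simp: cutoff_time_def)
qed

text \<open>Cutoff times are unique up to asymptotic equivalence, and the mixing times are among them.\<close>

lemma cutoff_time_mixing_time:
  assumes t: "cutoff_time D F t"
  shows "cutoff_time D F T"
proof -
  have tpos: "\<And>n. 1 \<le> n \<Longrightarrow> 0 < t n" using t by (simp add: cutoff_time_def)
  have up: "(\<lambda>n. d n (a * T n)) \<longlonglongrightarrow> 0" if a: "1 < a" for a
  proof -
    obtain b where b: "1 < b" "b < a" using a dense by blast
    have "\<forall>\<^sub>F n in sequentially. b / a * t n \<le> T n"
      using a b by (intro cutoff_time_compare(2)[OF t]) auto
    then have le: "\<forall>\<^sub>F n in sequentially. d n (a * T n) \<le> d n (b * t n)"
      using eventually_ge_at_top[of 1]
    proof eventually_elim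
      case (elim n)
      then show ?case using a b tpos[of n] by (intro d_antimono) (auto simp: field_simps)
    qed
    have ge: "\<forall>\<^sub>F n in sequentially. 0 \<le> d n (a * T n)"
      using a T_nonneg by (auto intro!: eventually_sequentiallyI[of 1] d_nonneg mult_nonneg_nonneg)
    show ?thesis
      using t b by (intro tendsto_sandwich[OF ge le]) (auto simp: cutoff_time_def)
  qed
  have down: "(\<lambda>n. d n (a * T n)) \<longlonglongrightarrow> 1" if a: "0 < a" "a < 1" for a
  proof -
    obtain b where b: "a < b" "b < 1" using a dense by blast
    have "\<forall>\<^sub>F n in sequentially. T n \<le> b / a * t n"
      using a b by (intro cutoff_time_compare(1)[OF t]) auto
    then have ge: "\<forall>\<^sub>F n in sequentially. d n (b * t n) \<le> d n (a * T n)"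
      using eventually_ge_at_top[of 1]
    proof eventually_elim
      case (elim n)
      then show ?case using a b T_gt_0[of n] by (intro d_antimono) (auto simp: field_simps)
    qed
    have le: "\<forall>\<^sub>F n in sequentially. d n (a * T n) \<le> 1"
      using a T_nonneg by (auto intro!: eventually_sequentiallyI[of 1] d_le_1 mult_nonneg_nonneg)
    show ?thesis
      using t a b by (intro tendsto_sandwich[OF ge le]) (auto simp: cutoff_time_def)
  qed
  show ?thesis
    using up down T_gt_0 by (auto simp: cutoff_time_def)
qed

lemma q_pos: "1 \<le> n \<Longrightarrow> 0 < weight_sum p n"
  by (rule weight_sum_pos) (simp_all add: p_pos)

lemma product_bounds:
  assumes n: "1 \<le> n" and u: "0 \<le> u"
  defines "t \<equiv> weight_sum p n * u / p n"
  shows "0 \<le> dP n t" "dP n t \<le> 1"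
    and "1 \<le> i \<Longrightarrow> i \<le> n \<Longrightarrow> d i (u * p i / p n) \<le> dP n t"
    and "(\<Prod>i=1..n. 1 - d i (u * p i / p n) powr rho D) \<le> 1 - dP n t powr rho D"
proof -
  have ch: "\<And>i. i \<in> {1..n} \<Longrightarrow> irreducible_mchain (F i)" "\<And>i. i \<in> {1..n} \<Longrightarrow> 0 < p i"
    using chains p_pos by auto
  have t: "0 \<le> t" using q_pos[OF n] p_pos[OF n] u by (simp add: t_def)
  have eq: "t * p i / weight_sum p n = u * p i / p n" for i
    using q_pos[OF n] by (simp add: t_def)
  note m = markov_at_product[where F = F and p = p and n = n, OF ch n t]
  show "0 \<le> dP n t" "dP n t \<le> 1" using chain_dist_nonneg[OF m] chain_dist_le_1[OF m] by auto
  show "d i (u * p i / p n) \<le> dP n t" if "1 \<le> i" "i \<le> n"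
    using chain_dist_product_ge[where F = F and p = p and n = n, OF ch n t, where i = i and D = D] that by (simp add: eq)
  show "(\<Prod>i=1..n. 1 - d i (u * p i / p n) powr rho D) \<le> 1 - dP n t powr rho D"
    using chain_dist_product_le[where F = F and p = p and n = n, OF ch n t, where D = D] by (simp add: eq)
qed

lemma product_sum_bound:
  assumes n: "1 \<le> n" and u: "0 \<le> u"
  shows "dP n (weight_sum p n * u / p n) powr rho D \<le> (\<Sum>i=1..n. d i (u * p i / p n) powr rho D)"
proof -
  have "0 \<le> u * p i / p n" if "1 \<le> i" for i
    using u p_pos[OF n] p_pos[OF that] by simp
  then have "1 - (\<Sum>i=1..n. d i (u * p i / p n) powr rho D) \<le>
      (\<Prod>i=1..n. 1 - d i (u * p i / p n) powr rho D)"
    using d_powr_bounds by (intro one_minus_sum_le_prod) auto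
  then show ?thesis using product_bounds(4)[OF n u] by linarith
qed

text \<open>Above the cutoff time the early coordinates are negligible by summability and each of the
  remaining ones by its own cutoff; below it the last coordinate suffices.\<close>

theorem product_cutoff_time:
  assumes t: "cutoff_time D F t"
  shows "cutoff_time D (product_family F p) (\<lambda>n. weight_sum p n * t n / p n)"
proof -
  have tpos: "\<And>n. 1 \<le> n \<Longrightarrow> 0 < t n" using t by (simp add: cutoff_time_def)
  have eq: "a * (weight_sum p n * t n / p n) = weight_sum p n * (a * t n) / p n" for a n
    by simp
  have "(\<lambda>n. dP n (weight_sum p n * (a * t n) / p n)) \<longlonglongrightarrow> 0" if a: "1 < a" for a
  proof (rule order_tendstoI)
    fix \<eta>' :: real assume \<eta>': "0 < \<eta>'"
    define \<eta> where "\<eta> = \<eta>' powr rho D"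
    have \<eta>: "0 < \<eta>" using \<eta>' by (simp add: \<eta>_def)
    have "\<forall>\<^sub>F n in sequentially. 1 * T n \<le> a * t n"
      using cutoff_time_compare(1)[OF t a] by simp
    then obtain m where m: "\<forall>\<^sub>F n in sequentially.
        (\<Sum>i=1..n - m. d i (a * t n * p i / p n) powr rho D) < \<eta> / 2"
      using early_components_negligible[OF c0(2), of "\<lambda>n. a * t n" "\<eta> / 2"] \<eta> by auto
    obtain b where b: "1 < b" "b < a" using a dense by blast
    have "\<forall>\<^sub>F n in sequentially. T n \<le> a / b * t n"
      using b by (intro cutoff_time_compare(1)[OF t]) auto
    then have bT: "\<forall>\<^sub>F n in sequentially. b * T n \<le> a * t n"
      by eventually_elim (use b in \<open>simp add: field_simps\<close>)
    have "(\<lambda>n. d n (b * T n)) \<longlonglongrightarrow> 0"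
      using cutoff_time_mixing_time[OF t] b by (simp add: cutoff_time_def)
    then have "\<forall>\<^sub>F n in sequentially. d n (b * T n) < (\<eta> / (2 * (m + 1))) powr (1 / rho D)"
      by (rule order_tendstoD) (use \<eta> in auto)
    then obtain i0 where i0: "\<And>i. i0 \<le> i \<Longrightarrow> d i (b * T i) < (\<eta> / (2 * (m + 1))) powr (1 / rho D)"
      by (auto simp: eventually_sequentially)
    \<comment> \<open>Half of \<open>\<eta>\<close> is spent on the coordinates up to \<open>n - m\<close>, the other half on the at most \<open>m\<close>
      remaining ones.\<close>
    have "\<forall>\<^sub>F n in sequentially. dP n (weight_sum p n * (a * t n) / p n) powr rho D < \<eta>"
      using m bT eventually_ge_at_top[of 1] eventually_ge_at_top[of "i0 + m"] eventually_ge_at_top[of N]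
    proof eventually_elim
      case (elim n)
      let ?x = "\<lambda>i. d i (a * t n * p i / p n) powr rho D"
      have "?x i \<le> \<eta> / (2 * (m + 1))" if i: "i \<in> {n - m<..n}" for i
      proof -
        have i1: "1 \<le> i" "i \<le> n" "i0 \<le> i" using i elim by auto
        have pos: "0 < p i" "0 < p n" "0 < T i" using p_pos T_gt_0 i1 elim by auto
        have "T i / p i \<le> T n / p n"
          using max_cond[OF elim(5) i1(1,2)] by (simp add: T_def)
        then have "b * T i \<le> b * T n * p i / p n"
          using pos b by (simp add: field_simps)
        also have "\<dots> \<le> a * t n * p i / p n"
          using elim(2) pos by (intro divide_right_mono mult_right_mono) auto
        finally have le: "d i (a * t n * p i / p n) \<le> d i (b * T i)"
          using b pos by (intro d_antimono i1) auto
        have "?x i \<le> ((\<eta> / (2 * (m + 1))) powr (1 / rho D)) powr rho D"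
          using le i0[OF i1(3)] pos a tpos[OF elim(3)] rho_ge_1
          by (intro powr_mono2 d_nonneg i1) auto
        then show ?thesis using \<eta> rho_ge_1 by (simp add: powr_powr)
      qed
      then have "(\<Sum>i\<in>{n - m<..n}. ?x i) \<le> real (card {n - m<..n}) * (\<eta> / (2 * (m + 1)))"
        by (rule sum_bounded_above)
      also have "\<dots> \<le> real (m + 1) * (\<eta> / (2 * (m + 1)))"
        using \<eta> by (intro mult_right_mono) auto
      also have "\<dots> = \<eta> / 2" by (simp add: field_simps)
      finally have window: "(\<Sum>i\<in>{n - m<..n}. ?x i) \<le> \<eta> / 2" .
      have "{1..n} = {1..n - m} \<union> {n - m<..n}" by auto
      then have "(\<Sum>i=1..n. ?x i) = (\<Sum>i=1..n - m. ?x i) + (\<Sum>i\<in>{n - m<..n}. ?x i)"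
        by (subst sum.union_disjoint[symmetric]) auto
      then have "(\<Sum>i=1..n. ?x i) < \<eta>" using elim(1) window by simp
      moreover have "0 \<le> a * t n" using a tpos[OF elim(3)] by simp
      ultimately show ?case
        using product_sum_bound[OF elim(3), of "a * t n"] by simp
    qed
    then show "\<forall>\<^sub>F n in sequentially. dP n (weight_sum p n * (a * t n) / p n) < \<eta>'"
      using eventually_ge_at_top[of 1]
    proof eventually_elim
      case (elim n)
      have "0 \<le> a * t n" using a tpos[OF elim(2)] by simp
      then have "0 \<le> dP n (weight_sum p n * (a * t n) / p n)"
        using product_bounds(1)[OF elim(2)] by simp
      then show ?case
        using elim(1) \<eta>' rho_pos[of D] powr_le_cancel_iff_nonneg[of "rho D" \<eta>' "dP n (weight_sum p n * (a * t n) / p n)"]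
        by (simp add: \<eta>_def linorder_not_le[symmetric])
    qed
  next
    fix y :: real assume y: "y < 0"
    show "\<forall>\<^sub>F n in sequentially. y < dP n (weight_sum p n * (a * t n) / p n)"
      using eventually_ge_at_top[of 1]
    proof eventually_elim
      case (elim n)
      have "0 \<le> a * t n" using a tpos[OF elim] by simp
      then show ?case using product_bounds(1)[OF elim] y by (meson less_le_trans)
    qed
  qed
  moreover have "(\<lambda>n. dP n (weight_sum p n * (a * t n) / p n)) \<longlonglongrightarrow> 1" if a: "0 < a" "a < 1" for a
  proof (rule tendsto_sandwich[where f = "\<lambda>n. d n (a * t n)" and h = "\<lambda>_. 1"])
    have nn: "0 \<le> a * t n" if "1 \<le> n" for n using a tpos[OF that] by simp
    show "\<forall>\<^sub>F n in sequentially. d n (a * t n) \<le> dP n (weight_sum p n * (a * t n) / p n)"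
      using eventually_ge_at_top[of 1]
    proof eventually_elim
      case (elim n)
      then show ?case using product_bounds(3)[OF elim nn[OF elim], of n] p_pos[OF elim] by simp
    qed
    show "\<forall>\<^sub>F n in sequentially. dP n (weight_sum p n * (a * t n) / p n) \<le> 1"
      by (intro eventually_sequentiallyI[of 1] product_bounds nn)
  qed (use t a in \<open>auto simp: cutoff_time_def\<close>)
  ultimately show ?thesis
    using tpos q_pos p_pos unfolding cutoff_time_def eq by auto
qed

text \<open>If no coordinate in the window were far from equilibrium, the window would contribute a
  factor of at least \<open>k ^ (m + 1)\<close> to the product over all coordinates, and the coordinates before
  it a factor of at least \<open>1 / 2\<close>, so that the distance of the product chain would stay bounded
  away from \<open>1\<close>. The tail estimate at \<open>a0\<close> serves all later times by monotonicity, so that \<open>m\<close>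
  does not depend on \<open>a\<close>.\<close>

lemma separated_component_in_window:
  assumes u: "\<And>n. 1 \<le> n \<Longrightarrow> 0 < u n"
    and tail: "\<forall>\<^sub>F n in sequentially. (\<Sum>i=1..n - m. d i (a0 * u n * p i / p n) powr rho D) < 1 / 2"
    and a: "0 < a0" "a0 \<le> a"
    and lim: "(\<lambda>n. dP n (weight_sum p n * (a * u n) / p n)) \<longlonglongrightarrow> 1"
    and \<kappa>: "0 < \<kappa>"
  shows "\<forall>\<^sub>F n in sequentially. \<exists>i\<in>{n - m..n}. 1 - \<kappa> < d i (a * u n * p i / p n)"
proof -
  define k where "k = min \<kappa> 1"
  have k: "0 < k" "k \<le> \<kappa>" "k \<le> 1" using \<kappa> by (auto simp: k_def)
  have "(\<lambda>n. dP n (weight_sum p n * (a * u n) / p n) powr rho D) \<longlonglongrightarrow> 1 powr rho D"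
    by (intro tendsto_powr lim tendsto_const) auto
  then have "(\<lambda>n. dP n (weight_sum p n * (a * u n) / p n) powr rho D) \<longlonglongrightarrow> 1" by simp
  moreover have "1 - k ^ (m + 1) / 2 < 1" using k by simp
  ultimately have "\<forall>\<^sub>F n in sequentially. 1 - k ^ (m + 1) / 2 < dP n (weight_sum p n * (a * u n) / p n) powr rho D"
    by (rule order_tendstoD)
  then show ?thesis
    using tail eventually_gt_at_top[of m]
  proof eventually_elim
    case (elim n)
    have n: "1 \<le> n" using elim by simp
    let ?x = "\<lambda>i. d i (a * u n * p i / p n) powr rho D"
    have un: "0 \<le> a * u n" using a u[OF n] by simp
    have time: "0 \<le> a0 * u n * p i / p n" "a0 * u n * p i / p n \<le> a * u n * p i / p n" if "1 \<le> i" for i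
      using a u[OF n] p_pos[OF n] p_pos[OF that]
      by (auto intro!: divide_right_mono mult_right_mono)
    have x: "0 \<le> ?x i" "?x i \<le> 1" "?x i \<le> d i (a0 * u n * p i / p n) powr rho D" if "1 \<le> i" for i
    proof -
      have t0: "0 \<le> a * u n * p i / p n" using time[OF that] by linarith
      show "0 \<le> ?x i" "?x i \<le> 1" using d_powr_bounds[OF that t0] .
      show "?x i \<le> d i (a0 * u n * p i / p n) powr rho D"
        using d_antimono[OF that time[OF that]] d_nonneg[OF that t0] rho_ge_1 by (intro powr_mono2) auto
    qed
    show ?case
    proof (rule ccontr)
      assume neg: "\<not> ?thesis"
      have xk: "k \<le> 1 - ?x i" if i: "i \<in> {n - m..n}" for i
      proof -
        have i1: "1 \<le> i" using i elim by auto
        have "0 \<le> a * u n * p i / p n" using time[OF i1] by linarith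
        then have "?x i \<le> d i (a * u n * p i / p n) powr 1"
          using rho_ge_1 d_nonneg[OF i1] d_le_1[OF i1] by (intro powr_mono') auto
        also have "\<dots> = d i (a * u n * p i / p n)"
          using d_nonneg[OF i1 \<open>0 \<le> a * u n * p i / p n\<close>] by simp
        also have "\<dots> \<le> 1 - \<kappa>" using neg i by force
        finally show ?thesis using k by simp
      qed
      have low: "1 / 2 \<le> (\<Prod>i=1..n - m - 1. 1 - ?x i)"
      proof -
        have "(\<Sum>i=1..n - m - 1. ?x i) \<le> (\<Sum>i=1..n - m - 1. d i (a0 * u n * p i / p n) powr rho D)"
          using x by (intro sum_mono) auto
        also have "\<dots> \<le> (\<Sum>i=1..n - m. d i (a0 * u n * p i / p n) powr rho D)"
          by (intro sum_mono2) auto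
        finally have "1 / 2 \<le> 1 - (\<Sum>i=1..n - m - 1. ?x i)" using elim by simp
        also have "\<dots> \<le> (\<Prod>i=1..n - m - 1. 1 - ?x i)"
          using x by (intro one_minus_sum_le_prod) auto
        finally show ?thesis .
      qed
      have "k ^ (m + 1) = (\<Prod>i\<in>{n - m..n}. k)" using elim by (simp add: Suc_diff_le)
      also have "\<dots> \<le> (\<Prod>i\<in>{n - m..n}. 1 - ?x i)"
        using k xk by (intro prod_mono) auto
      finally have window: "k ^ (m + 1) \<le> (\<Prod>i\<in>{n - m..n}. 1 - ?x i)" .
      have "{1..n} = {1..n - m - 1} \<union> {n - m..n}" using elim by auto
      then have "(\<Prod>i=1..n. 1 - ?x i) = (\<Prod>i=1..n - m - 1. 1 - ?x i) * (\<Prod>i\<in>{n - m..n}. 1 - ?x i)"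
        by (subst prod.union_disjoint[symmetric]) (use elim in auto)
      also have "\<dots> \<ge> 1 / 2 * k ^ (m + 1)"
        using low window k by (intro mult_mono) auto
      finally have "k ^ (m + 1) / 2 \<le> (\<Prod>i=1..n. 1 - ?x i)" by simp
      also have "\<dots> \<le> 1 - dP n (weight_sum p n * (a * u n) / p n) powr rho D"
        using product_bounds(4)[OF n un] by simp
      finally show False using elim(1) by simp
    qed
  qed
qed

text \<open>The times \<open>u n\<close> are asymptotically at least \<open>T n\<close>, as the last coordinate is in equilibrium
  just after them. So at \<open>a0 * u n\<close>, for some \<open>a0\<close> strictly between \<open>c0\<close> and \<open>1\<close>, the early
  coordinates are still negligible, which fixes the length \<open>m\<close> of the window. At stage \<open>k\<close> one
  selects some \<open>n\<close> and a coordinate in its window that is far from equilibrium at \<open>lo k * u n\<close> and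
  close to it at \<open>up k * u n\<close>, where \<open>lo k\<close> and \<open>up k\<close> tend to \<open>1\<close> from below and from above. The
  selected coordinates form the subfamily.\<close>

theorem subfamily_cutoff:
  assumes "has_cutoff D (product_family F p)"
  shows "\<exists>\<xi>. increasing_pos_seq \<xi> \<and> has_cutoff D (F \<circ> \<xi>)"
proof -
  obtain s where s: "cutoff_time D (product_family F p) s"
    using assms by (auto simp: has_cutoff_def)
  define u where "u n = s n * p n / weight_sum p n" for n
  have upos: "0 < u n" if "1 \<le> n" for n
    using s q_pos[OF that] p_pos[OF that] that by (simp add: u_def cutoff_time_def)
  have us: "weight_sum p n * (a * u n) / p n = a * s n" if "1 \<le> n" for a n
    using q_pos[OF that] p_pos[OF that] by (simp add: u_def)
  have lim: "(\<lambda>n. dP n (weight_sum p n * (a * u n) / p n)) \<longlonglongrightarrow> l"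
    if "(\<lambda>n. dP n (a * s n)) \<longlonglongrightarrow> l" for a l
    using that by (rule Lim_transform_eventually) (auto simp: us intro!: eventually_sequentiallyI[of 1])
  have above: "(\<lambda>n. dP n (weight_sum p n * (a * u n) / p n)) \<longlonglongrightarrow> 0" if "1 < a" for a
    using s that by (intro lim) (auto simp: cutoff_time_def)
  have below: "(\<lambda>n. dP n (weight_sum p n * (a * u n) / p n)) \<longlonglongrightarrow> 1" if "0 < a" "a < 1" for a
    using s that by (intro lim) (auto simp: cutoff_time_def)
  have comp: "d i (a * u n * p i / p n) \<le> dP n (weight_sum p n * (a * u n) / p n)"
    if "0 < a" "1 \<le> i" "i \<le> n" for a i n
    using that upos[of n] by (intro product_bounds) auto
  have T_le_u: "\<forall>\<^sub>F n in sequentially. T n \<le> b * u n" if b: "1 < b" for b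
  proof (rule T_le_eventually)
    have nn: "0 \<le> b * u n" if "1 \<le> n" for n using b upos[OF that] by simp
    then show "\<forall>\<^sub>F n in sequentially. 0 \<le> b * u n"
      by (rule eventually_sequentiallyI)
    show "(\<lambda>n. d n (b * u n)) \<longlonglongrightarrow> 0"
    proof (rule tendsto_sandwich[OF _ _ tendsto_const above[OF b]])
      show "\<forall>\<^sub>F n in sequentially. 0 \<le> d n (b * u n)"
        by (intro eventually_sequentiallyI[of 1] d_nonneg nn)
      show "\<forall>\<^sub>F n in sequentially. d n (b * u n) \<le> dP n (weight_sum p n * (b * u n) / p n)"
      proof (rule eventually_sequentiallyI[of 1])
        fix n :: nat assume n: "1 \<le> n"
        show "d n (b * u n) \<le> dP n (weight_sum p n * (b * u n) / p n)"
          using comp[of b n n] b n p_pos[OF n] by simp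
      qed
    qed
  qed
  define a0 where "a0 = (1 + c0) / 2"
  have a0: "c0 < a0" "a0 < 1" "0 < a0" using c0 by (auto simp: a0_def)
  \<comment> \<open>The gap between \<open>c0\<close> and \<open>a0\<close> absorbs the factor \<open>b\<close> by which \<open>T n\<close> may exceed \<open>u n\<close>.\<close>
  have "1 < a0 / c0" using a0 c0 by simp
  then obtain b where b: "1 < b" "b < a0 / c0" using dense by blast
  have ev: "\<forall>\<^sub>F n in sequentially. a0 / b * T n \<le> a0 * u n"
    using T_le_u[OF b(1)] by eventually_elim (use a0 b in \<open>simp add: field_simps\<close>)
  have cb: "c0 < a0 / b" using b c0 a0 by (simp add: field_simps)
  obtain m where m: "\<forall>\<^sub>F n in sequentially. (\<Sum>i=1..n - m. d i (a0 * u n * p i / p n) powr rho D) < 1 / 2"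
    using early_components_negligible[OF cb ev, of "1 / 2"] by auto
  define lo up where "lo k = 1 - (1 - a0) / real (Suc k)" and "up k = 1 + 1 / real (Suc k)" for k
  have lo: "a0 \<le> lo k" "lo k < 1" for k
    using a0 mult_right_mono[of 1 "1 + real k" "1 - a0"] by (auto simp: lo_def field_simps)
  have up: "1 < up k" for k by (simp add: up_def)
  define good where "good k i n \<longleftrightarrow> 1 \<le> i \<and> i \<le> n \<and>
      1 - 1 / real (Suc k) < d i (lo k * u n * p i / p n) \<and> d i (up k * u n * p i / p n) < 1 / real (Suc k)" for k i n
  have ex: "\<exists>i n. good k i n \<and> M < i" for k M
  proof -
    have "\<forall>\<^sub>F n in sequentially. \<exists>i\<in>{n - m..n}. 1 - 1 / real (Suc k) < d i (lo k * u n * p i / p n)"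
      using lo a0 by (intro separated_component_in_window[OF upos m] below) (auto intro: less_le_trans[OF a0(3)])
    moreover have "\<forall>\<^sub>F n in sequentially. dP n (weight_sum p n * (up k * u n) / p n) < 1 / real (Suc k)"
      using above[OF up] by (rule order_tendstoD) simp
    ultimately have "\<forall>\<^sub>F n in sequentially. \<exists>i. good k i n \<and> M < i"
      using eventually_gt_at_top[of "M + m"]
    proof eventually_elim
      case (elim n)
      then obtain i where i: "i \<in> {n - m..n}" "1 - 1 / real (Suc k) < d i (lo k * u n * p i / p n)" by blast
      then have i1: "1 \<le> i" "i \<le> n" "M < i" using elim(3) by auto
      have "d i (up k * u n * p i / p n) < 1 / real (Suc k)"
        using comp[of "up k" i n] up[of k] i1 elim(2) by linarith
      then show ?case using i i1 unfolding good_def by blast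
    qed
    then obtain n where "\<exists>i. good k i n \<and> M < i"
      using eventually_happens'[OF sequentially_bot] by blast
    then show ?thesis by blast
  qed
  have "\<exists>f. \<forall>k. good k (fst (f k)) (snd (f k)) \<and> fst (f k) < fst (f (Suc k))"
    using dependent_nat_choice[of "\<lambda>k z. good k (fst z) (snd z)" "\<lambda>k z z'. fst z < fst z'"] ex
    by (metis fst_conv snd_conv)
  then obtain f where f: "\<And>k. good k (fst (f k)) (snd (f k))" "\<And>k. fst (f k) < fst (f (Suc k))"
    by blast
  define \<xi> where "\<xi> k = fst (f k)" for k
  define v where "v k = u (snd (f k)) * p (\<xi> k) / p (snd (f k))" for k
  have \<xi>: "increasing_pos_seq \<xi>"
  proof (rule increasing_pos_seq_strict_mono)
    show "strict_mono \<xi>" using f(2) by (simp add: strict_mono_Suc_iff \<xi>_def)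
    show "1 \<le> \<xi> 0" using f(1)[of 0] by (simp add: good_def \<xi>_def)
  qed
  have ok: "1 \<le> \<xi> k" "1 \<le> snd (f k)" "1 - 1 / real (Suc k) < d (\<xi> k) (lo k * v k)"
    "d (\<xi> k) (up k * v k) < 1 / real (Suc k)" for k
    using f(1)[of k] by (auto simp: good_def \<xi>_def v_def mult.assoc)
  have vpos: "0 < v k" for k
    using ok[of k] upos p_pos by (simp add: v_def)
  have vnn: "0 \<le> v k" for k
    using vpos[of k] by simp
  have to0: "(\<lambda>k. 1 / real (Suc k)) \<longlonglongrightarrow> 0" using LIMSEQ_inverse_real_of_nat by (simp add: inverse_eq_divide)
  have hi: "(\<lambda>k. d (\<xi> k) (a * v k)) \<longlonglongrightarrow> 0" if a: "1 < a" for a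
  proof (rule tendsto_sandwich[OF _ _ tendsto_const to0])
    show "\<forall>\<^sub>F k in sequentially. 0 \<le> d (\<xi> k) (a * v k)"
      using a vnn ok by (auto intro!: always_eventually d_nonneg mult_nonneg_nonneg)
    have "\<forall>\<^sub>F k in sequentially. 1 / real (Suc k) < a - 1"
      by (rule order_tendstoD(2)[OF to0]) (use a in simp)
    then show "\<forall>\<^sub>F k in sequentially. d (\<xi> k) (a * v k) \<le> 1 / real (Suc k)"
    proof eventually_elim
      case (elim k)
      have "d (\<xi> k) (a * v k) \<le> d (\<xi> k) (up k * v k)"
        using elim up[of k] vpos[of k] ok(1)[of k] by (intro d_antimono mult_right_mono) (auto simp: up_def)
      then show ?case using ok(4)[of k] by simp
    qed
  qed
  have low: "(\<lambda>k. d (\<xi> k) (a * v k)) \<longlonglongrightarrow> 1" if a: "0 < a" "a < 1" for a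
  proof (rule tendsto_sandwich[where f = "\<lambda>k. 1 - 1 / real (Suc k)" and h = "\<lambda>_. 1"])
    show "(\<lambda>k. 1 - 1 / real (Suc k)) \<longlonglongrightarrow> 1"
      using tendsto_diff[OF tendsto_const to0, of 1] by simp
    show "\<forall>\<^sub>F k in sequentially. d (\<xi> k) (a * v k) \<le> 1"
      using a vnn ok by (auto intro!: always_eventually d_le_1 mult_nonneg_nonneg)
    have "(\<lambda>k. 1 - (1 - a0) * (1 / real (Suc k))) \<longlonglongrightarrow> 1 - (1 - a0) * 0"
      by (intro tendsto_intros to0)
    then have "\<forall>\<^sub>F k in sequentially. a < 1 - (1 - a0) * (1 / real (Suc k))"
      by (rule order_tendstoD) (use a in simp)
    then show "\<forall>\<^sub>F k in sequentially. 1 - 1 / real (Suc k) \<le> d (\<xi> k) (a * v k)"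
    proof eventually_elim
      case (elim k)
      have "d (\<xi> k) (lo k * v k) \<le> d (\<xi> k) (a * v k)"
        using elim a vpos[of k] ok(1)[of k] by (intro d_antimono mult_right_mono) (auto simp: lo_def)
      then show ?case using ok(3)[of k] by simp
    qed
  qed simp
  have "cutoff_time D (F \<circ> \<xi>) v"
    using vpos hi low by (simp add: cutoff_time_def)
  then show ?thesis using \<xi> by (auto simp: has_cutoff_def)
qed

text \<open>The sums over a subfamily are partial sums of those over the family, because
  \<open>\<xi> i \<le> \<xi> n - m\<close> for \<open>i \<le> n - m\<close>.\<close>

lemma subfamily:
  assumes \<xi>: "increasing_pos_seq \<xi>"
  shows "cutoff_setting D (F \<circ> \<xi>) (p \<circ> \<xi>) (\<epsilon> \<circ> \<xi>) c0 (max N 1) \<theta> \<delta>"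
proof
  note pos = increasing_pos_seq_pos[OF \<xi>]
  note T_def[symmetric, simp]
  show "mixing_time D ((F \<circ> \<xi>) i) ((\<epsilon> \<circ> \<xi>) i) / (p \<circ> \<xi>) i \<le> mixing_time D ((F \<circ> \<xi>) n) ((\<epsilon> \<circ> \<xi>) n) / (p \<circ> \<xi>) n"
    if n: "max N 1 \<le> n" and i: "1 \<le> i" "i \<le> n" for n i
  proof -
    have "N \<le> \<xi> n" using increasing_pos_seq_ge[OF \<xi>, of n] n by simp
    moreover have "\<xi> i \<le> \<xi> n" using increasing_pos_seq_gap[OF \<xi> i] by simp
    ultimately show ?thesis using max_cond[of "\<xi> n" "\<xi> i"] pos[OF i(1)] by simp
  qed
  fix \<eta> :: real assume "0 < \<eta>"
  define h where "h n i = \<theta> powr (c0 * rho D * T n * p i / (T i * p n))" for n i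
  obtain m where "\<forall>\<^sub>F n in sequentially. (\<Sum>i=1..n - m. h n i) < \<eta>"
    using lim_cond[OF \<open>0 < \<eta>\<close>] by (auto simp: h_def)
  then obtain M where M: "\<And>n. M \<le> n \<Longrightarrow> (\<Sum>i=1..n - m. h n i) < \<eta>"
    by (auto simp: eventually_sequentially)
  have "(\<Sum>i=1..n - m. h (\<xi> n) (\<xi> i)) < \<eta>" if n: "M + m + 1 \<le> n" for n
  proof -
    have inj: "inj_on \<xi> {1..n - m}"
      by (rule inj_onI) (metis \<xi> atLeastAtMost_iff increasing_pos_seq_less less_irrefl nat_neq_iff)
    have sub: "\<xi> ` {1..n - m} \<subseteq> {1..\<xi> n - m}"
    proof
      fix j assume "j \<in> \<xi> ` {1..n - m}"
      then obtain i where i: "j = \<xi> i" "1 \<le> i" "i \<le> n - m" by auto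
      have "\<xi> i + (n - i) \<le> \<xi> n" using i n by (intro increasing_pos_seq_gap[OF \<xi>]) auto
      moreover have "m \<le> n - i" using i n by simp
      ultimately have "\<xi> i + m \<le> \<xi> n" by linarith
      then show "j \<in> {1..\<xi> n - m}" using pos[OF i(2)] i(1) by simp
    qed
    have "(\<Sum>i=1..n - m. h (\<xi> n) (\<xi> i)) = (\<Sum>j\<in>\<xi> ` {1..n - m}. h (\<xi> n) j)"
      by (subst sum.reindex[OF inj]) simp
    also have "\<dots> \<le> (\<Sum>j=1..\<xi> n - m. h (\<xi> n) j)"
      using sub by (intro sum_mono2) (auto simp: h_def)
    also have "\<dots> < \<eta>"
      using increasing_pos_seq_ge[OF \<xi>, of n] n by (intro M) auto
    finally show ?thesis .
  qed
  then show "\<exists>m. \<forall>\<^sub>F n in sequentially. (\<Sum>i=1..n - m. \<theta> powr (c0 * rho D *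
      mixing_time D ((F \<circ> \<xi>) n) ((\<epsilon> \<circ> \<xi>) n) * (p \<circ> \<xi>) i /
      (mixing_time D ((F \<circ> \<xi>) i) ((\<epsilon> \<circ> \<xi>) i) * (p \<circ> \<xi>) n))) < \<eta>"
    by (auto simp: h_def intro!: exI[of _ m] eventually_sequentiallyI[of "M + m + 1"])
qed (use chains p_pos c0 \<delta> \<theta> T_finite T_pos increasing_pos_seq_pos[OF \<xi>] in auto)

text \<open>If the mixing times are no cutoff times, then for some \<open>a\<close> the distances at \<open>a * T n\<close> stay
  away from their required limit along a subsequence. This excludes a cutoff for every further
  subfamily, as its mixing times would have to be cutoff times.\<close>

lemma no_cutoff_subfamily:
  assumes no: "\<not> has_cutoff D F"
  shows "\<exists>\<xi>. increasing_pos_seq \<xi> \<and> (\<forall>\<zeta>. increasing_pos_seq \<zeta> \<longrightarrow> \<not> has_cutoff D (F \<circ> (\<xi> \<circ> \<zeta>)))"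
proof -
  define L where "L a = (if 1 < a then 0 else 1 :: real)" for a :: real
  have iff: "cutoff_time D F' t \<longleftrightarrow> (\<forall>n\<ge>1. 0 < t n) \<and>
      (\<forall>a>0. a \<noteq> 1 \<longrightarrow> (\<lambda>n. chain_dist D (F' n) (a * t n)) \<longlonglongrightarrow> L a)" for F' :: "nat \<Rightarrow> 'a mchain" and t
    unfolding cutoff_time_def L_def
    by (smt (verit, ccfv_threshold) linorder_neqE_linordered_idom zero_less_one)
  have "\<not> cutoff_time D F T" using no by (auto simp: has_cutoff_def)
  then obtain a where a: "0 < a" "a \<noteq> 1" "\<not> (\<lambda>n. d n (a * T n)) \<longlonglongrightarrow> L a"
    using T_gt_0 unfolding iff by blast
  then obtain \<kappa> where \<kappa>: "0 < \<kappa>" "\<not> (\<forall>\<^sub>F n in sequentially. dist (d n (a * T n)) (L a) < \<kappa>)"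
    by (auto simp: tendsto_iff)
  have "\<exists>n\<ge>k. 1 \<le> n \<and> \<not> dist (d n (a * T n)) (L a) < \<kappa>" for k
    using \<kappa>(2) unfolding eventually_sequentially by (metis max.bounded_iff nle_le max.cobounded1 max.cobounded2)
  then have "infinite {n. 1 \<le> n \<and> \<not> dist (d n (a * T n)) (L a) < \<kappa>}"
    unfolding infinite_nat_iff_unbounded_le by blast
  from infinite_enumerate[OF this] obtain \<xi> :: "nat \<Rightarrow> nat"
    where \<xi>: "strict_mono \<xi>" "\<And>n. 1 \<le> \<xi> n" "\<And>n. \<kappa> \<le> dist (d (\<xi> n) (a * T (\<xi> n))) (L a)"
    unfolding mem_Collect_eq not_less by metis
  then have inc: "increasing_pos_seq \<xi>" by (intro increasing_pos_seq_strict_mono)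
  have "\<not> has_cutoff D (F \<circ> (\<xi> \<circ> \<zeta>))" if \<zeta>: "increasing_pos_seq \<zeta>" for \<zeta>
  proof
    assume "has_cutoff D (F \<circ> (\<xi> \<circ> \<zeta>))"
    then obtain t where t: "cutoff_time D (F \<circ> (\<xi> \<circ> \<zeta>)) t" by (auto simp: has_cutoff_def)
    interpret sub: cutoff_setting D "F \<circ> (\<xi> \<circ> \<zeta>)" "p \<circ> (\<xi> \<circ> \<zeta>)" "\<epsilon> \<circ> (\<xi> \<circ> \<zeta>)" c0 "max N 1" \<theta> \<delta>
      by (intro subfamily increasing_pos_seq_comp inc \<zeta>)
    have "sub.T n = T (\<xi> (\<zeta> n))" for n by (simp add: sub.T_def T_def)
    then have "(\<lambda>n. d (\<xi> (\<zeta> n)) (a * T (\<xi> (\<zeta> n)))) \<longlonglongrightarrow> L a"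
      using sub.cutoff_time_mixing_time[OF t] a(1,2) unfolding iff by simp
    then have "\<forall>\<^sub>F n in sequentially. dist (d (\<xi> (\<zeta> n)) (a * T (\<xi> (\<zeta> n)))) (L a) < \<kappa>"
      using \<kappa>(1) by (simp add: tendsto_iff)
    then show False
      using \<xi>(3) eventually_happens[of _ sequentially] by (force simp: linorder_not_less[symmetric])
  qed
  with inc show ?thesis by blast
qed

end
theorem theorem4p6:
  fixes F :: "nat \<Rightarrow> 'a mchain" and p \<epsilon> :: "nat \<Rightarrow> real"
    and D :: dist_kind and c\<^sub>0 :: real and N :: nat
  defines "T \<equiv> \<lambda>n. mixing_time D (F n) (\<epsilon> n)"
  assumes chains: "\<And>n. n \<ge> 1 \<Longrightarrow> irreducible_mchain (F n)"
    and p_pos: "\<And>n. n \<ge> 1 \<Longrightarrow> 0 < p n"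
    and c0: "0 < c\<^sub>0" "c\<^sub>0 < 1"
    and N: "0 < N"
    and eps_bdd: "bdd_below (\<epsilon> ` {1..})" "bdd_above (\<epsilon> ` {1..})"
    and eps: "0 < (INF n\<in>{1..}. \<epsilon> n)" "(SUP n\<in>{1..}. \<epsilon> n) < 1 / (2 * rho D)"
    and T_finite: "\<And>n. n \<ge> 1 \<Longrightarrow> mixing_finite D (F n) (\<epsilon> n)"
    and T_pos: "\<And>n. n \<ge> 1 \<Longrightarrow> 0 < T n"
    and max_cond: "\<And>n. n \<ge> N \<Longrightarrow> Max ((\<lambda>i. T i / p i) ` {1..n}) = T n / p n"
    and lim_cond: "(\<lambda>m. limsup (\<lambda>n. ereal (\<Sum>i=1..n - m.
        (2 * rho D * (SUP k\<in>{1..}. \<epsilon> k)) powr (c\<^sub>0 * rho D * T n * p i / (T i * p n))))) \<longlonglongrightarrow> 0"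
  shows
    "(has_cutoff D F \<longleftrightarrow>
       (\<forall>\<xi>. increasing_pos_seq \<xi> \<longrightarrow> has_cutoff D (product_family (F \<circ> \<xi>) (p \<circ> \<xi>)))) \<and>
     (has_cutoff D F \<longrightarrow> has_cutoff D (product_family F p)) \<and>
     ((\<forall>\<xi>. increasing_pos_seq \<xi> \<longrightarrow> \<not> has_cutoff D (F \<circ> \<xi>)) \<longleftrightarrow>
       (\<forall>\<xi>. increasing_pos_seq \<xi> \<longrightarrow> \<not> has_cutoff D (product_family (F \<circ> \<xi>) (p \<circ> \<xi>)))) \<and>
     ((\<forall>\<xi>. increasing_pos_seq \<xi> \<longrightarrow> \<not> has_cutoff D (F \<circ> \<xi>)) \<longrightarrow>
       \<not> has_cutoff D (product_family F p)) \<and>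
     (\<forall>t. cutoff_time D F t \<longrightarrow>
       cutoff_time D (product_family F p) (\<lambda>n. weight_sum p n * t n / p n))"
proof -
  define \<theta> \<delta> where "\<theta> = 2 * rho D * (SUP k\<in>{1..}. \<epsilon> k)" and "\<delta> = (INF n\<in>{1..}. \<epsilon> n)"
  have rho: "0 < rho D" by (rule rho_pos)
  have setting: "cutoff_setting D F p \<epsilon> c\<^sub>0 (max N 1) \<theta> \<delta>"
  proof
    show "\<theta> < 1" using eps(2) rho by (simp add: \<theta>_def field_simps)
    show "2 * rho D * \<epsilon> n \<le> \<theta>" if "n \<ge> 1" for n
      unfolding \<theta>_def using that rho by (intro mult_left_mono cSUP_upper eps_bdd) auto
    show "\<delta> \<le> \<epsilon> n" if "n \<ge> 1" for n
      unfolding \<delta>_def using that by (intro cINF_lower eps_bdd) auto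
    show "mixing_time D (F i) (\<epsilon> i) / p i \<le> mixing_time D (F n) (\<epsilon> n) / p n"
      if "max N 1 \<le> n" "1 \<le> i" "i \<le> n" for n i
    proof -
      have "T i / p i \<le> Max ((\<lambda>i. T i / p i) ` {1..n})" using that by (intro Max_ge) auto
      also have "\<dots> = T n / p n" using that by (intro max_cond) simp
      finally show ?thesis by (simp add: T_def)
    qed
    fix \<eta> :: real assume "0 < \<eta>"
    then have "\<forall>\<^sub>F m in sequentially. limsup (\<lambda>n. ereal (\<Sum>i=1..n - m.
        \<theta> powr (c\<^sub>0 * rho D * T n * p i / (T i * p n)))) < ereal \<eta>"
      using order_tendstoD(2)[OF lim_cond, of "ereal \<eta>"] by (simp add: \<theta>_def)
    then obtain m where "limsup (\<lambda>n. ereal (\<Sum>i=1..n - m.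
        \<theta> powr (c\<^sub>0 * rho D * T n * p i / (T i * p n)))) < ereal \<eta>"
      using eventually_happens[of _ sequentially] by auto
    then have "\<forall>\<^sub>F n in sequentially. ereal (\<Sum>i=1..n - m.
        \<theta> powr (c\<^sub>0 * rho D * T n * p i / (T i * p n))) < ereal \<eta>"
      by (rule Limsup_lessD)
    then show "\<exists>m. \<forall>\<^sub>F n in sequentially. (\<Sum>i=1..n - m. \<theta> powr (c\<^sub>0 * rho D *
        mixing_time D (F n) (\<epsilon> n) * p i / (mixing_time D (F i) (\<epsilon> i) * p n))) < \<eta>"
      by (auto simp: T_def)
  qed (use chains p_pos c0 eps T_finite T_pos in \<open>auto simp: T_def \<delta>_def\<close>)
  then interpret cutoff_setting D F p \<epsilon> c\<^sub>0 "max N 1" \<theta> \<delta> .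
  have product: "has_cutoff D (product_family (F \<circ> \<xi>) (p \<circ> \<xi>))"
    if "increasing_pos_seq \<xi>" "has_cutoff D (F \<circ> \<xi>)" for \<xi>
    using cutoff_setting.product_cutoff_time[OF subfamily[OF that(1)]] that(2) unfolding has_cutoff_def by blast
  have factor: "\<exists>\<zeta>. increasing_pos_seq \<zeta> \<and> has_cutoff D (F \<circ> (\<xi> \<circ> \<zeta>))"
    if "increasing_pos_seq \<xi>" "has_cutoff D (product_family (F \<circ> \<xi>) (p \<circ> \<xi>))" for \<xi>
    using cutoff_setting.subfamily_cutoff[OF subfamily[OF that(1)] that(2)] by (simp add: comp_assoc)
  have sub: "has_cutoff D (F \<circ> \<xi>)" if \<xi>: "increasing_pos_seq \<xi>" and "has_cutoff D F" for \<xi>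
  proof -
    obtain t where t: "cutoff_time D F t" using \<open>has_cutoff D F\<close> by (auto simp: has_cutoff_def)
    have lim: "filterlim \<xi> at_top sequentially"
      using increasing_pos_seq_ge[OF \<xi>] by (intro filterlim_at_top_mono[OF filterlim_ident])
        (auto intro!: eventually_sequentiallyI[of 1])
    have "(\<lambda>n. d (\<xi> n) (a * t (\<xi> n))) \<longlonglongrightarrow> l" if "(\<lambda>n. d n (a * t n)) \<longlonglongrightarrow> l" for a l
      using filterlim_compose[OF that lim] .
    then have "cutoff_time D (F \<circ> \<xi>) (t \<circ> \<xi>)"
      using t increasing_pos_seq_pos[OF \<xi>] unfolding cutoff_time_def comp_def by auto
    then show ?thesis by (auto simp: has_cutoff_def)
  qed
  have whole: "has_cutoff D F \<Longrightarrow> has_cutoff D (product_family F p)"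
    using product_cutoff_time by (auto simp: has_cutoff_def)
  have converse: "has_cutoff D F" if all: "\<forall>\<xi>. increasing_pos_seq \<xi> \<longrightarrow> has_cutoff D (product_family (F \<circ> \<xi>) (p \<circ> \<xi>))"
  proof (rule ccontr)
    assume "\<not> has_cutoff D F"
    then obtain \<xi> where "increasing_pos_seq \<xi>" "\<forall>\<zeta>. increasing_pos_seq \<zeta> \<longrightarrow> \<not> has_cutoff D (F \<circ> (\<xi> \<circ> \<zeta>))"
      using no_cutoff_subfamily by blast
    then show False using factor all by blast
  qed
  have "(\<forall>\<xi>. increasing_pos_seq \<xi> \<longrightarrow> \<not> has_cutoff D (F \<circ> \<xi>)) \<longleftrightarrow>
      (\<forall>\<xi>. increasing_pos_seq \<xi> \<longrightarrow> \<not> has_cutoff D (product_family (F \<circ> \<xi>) (p \<circ> \<xi>)))"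
    using product factor increasing_pos_seq_comp by blast
  moreover have "(\<forall>\<xi>. increasing_pos_seq \<xi> \<longrightarrow> \<not> has_cutoff D (F \<circ> \<xi>)) \<longrightarrow> \<not> has_cutoff D (product_family F p)"
    using subfamily_cutoff by blast
  ultimately show ?thesis
    using product sub whole converse product_cutoff_time by blast
qed

end
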